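(* Let $S=(L,A,\le)$ be an abstract numeration system where $L$ is recognized by a totally ordered Pisot automaton $\mathcal{A}_L=(\{0,1,\ldots,d\},A,\tau,d,\{1,\ldots,d\})$ (with $d\ge 1$, and with the states ordered by the usual order on integers) such that $\tau(0,a)=0$ for every $a\in A$, and $\tau(q,a_0)>0$ for every state $q>0$, where $a_0$ is the minimal letter of $A$. Then the abstract van der Corput sequence $(x_n)_{n\ge 0}$ corresponding to $S$ is a low discrepancy sequence, i.e. $\sup_I D(N,I)=\mathcal{O}(\log N)$, where the supremum is over all intervals $I\subseteq[0,1)$.
   Context: **Words.** $(A,\le)$ is a finite totally ordered alphabet, $A^*$ the set of finite words over $A$, $A^\omega$ the set of right-infinite words, $|w|$ the length of $w$. $A^*$ carries the shortlex order: $v<w$ iff $|v|<|w|$, or $|v|=|w|$ and $v$ is lexicographically smaller than $w$. $A^\omega$ carries the lexicographical order. The mirror image of $w=w_1\cdots w_k$ is $\widetilde w=w_k\cdots w_1$, and $\widetilde L=\{\widetilde w: w\in L\}$. **Abstract numeration system.** A triple $S=(L,A,\le)$ with $L\subseteq A^*$ an infinite regular language; $\mathrm{val}_S(w)=\#\{v\in L: v<w\}$ for $w\in L$, and $\mathrm{rep}_S(n)=w$ iff $\mathrm{val}_S(w)=n$. **Automata.** A deterministic automaton $(Q,A,\tau,q_0,F)$ (states $Q$, transition function $\tau:Q\times A\to Q$, initial state $q_0$, final states $F$), with $\tau$ extended to words by $\tau(q,\varepsilon)=q$, $\tau(q,wa)=\tau(\tau(q,w),a)$, recognizes $\{w:\tau(q_0,w)\in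 F\}$. It is totally ordered if there is a total order on $Q$ such that $q\le r$ implies $\tau(q,a)\le\tau(r,a)$ for all $a\in A$. A state $q$ is accessible if $q=\tau(q_0,w)$ for some $w$, and co-accessible if $\tau(q,w)\in F$ for some $w\in A^*$. A deterministic automaton is a Pisot automaton if the incidence matrix $(\#\{a\in A:\tau(q,a)=r\})_{q,r}$ of its restriction to the states that are both accessible and co-accessible has one simple eigenvalue $\beta>1$, and all other eigenvalues $\alpha$ satisfy $|\alpha|<1$. **Normalized value.** Let $L$ have exponential growth, $\lim_{k\to\infty}\frac1k\log\#\{v\in L:|v|\le k\}=\log\beta>0$. Let $L_\omega$ be the set of $u\in A^\omega$ that are limits of words $w^{(k)}\in L$ (every finite prefix of $u$ is a prefix of all but finitely many $w^{(k)}$). For $u\in L_\omega$ put $\mathrm{val}_S^\omega(u)=\lim_{k\to\infty}\mathrm{val}_S(w^{(k)})/\#\{v\in L:|v|\le|w^{(k)}|\}$, if this limit exists and does not depend on the choice of $(w^{(k)})$, and $\langle u\rangle=\frac{\beta\,\mathrm{val}_S^\omega(u)-1}{\beta-1}\in[0,1]$. For $w\in L$ that is a prefix of some word in $L_\omega$, $\langle w\rangle=\langle u\rangle$ where $u$ is the smallest word in $L_\omega$ with prefix $w$. **Abstract van der Corput sequence.** It is defined when $L$ has exponential growth, every $w\in L$ is a prefix of some $u\in L_\omega$, and $\mathrm{val}_S^\omega(u)$ exists for every $u\in L_\omega$ (this is the case under the hypotheses of the claim). Let $L'=\{w\in L:\langle w\rangle\ne\langle v\rangle\text{ for every }v\in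 L\text{ with }v<w\}$ and let $\widetilde{S'}=(\widetilde{L'},A,\le)$. Then $x_n=\langle w\rangle$ where $\widetilde w=\mathrm{rep}_{\widetilde{S'}}(n)$. **Discrepancy.** $D(N,I)=\#\{0\le n<N:x_n\in I\}-N\lambda(I)$, where $\lambda(I)$ is the length of the interval $I$. *)

theory Defs
  imports
    "HOL-Analysis.Analysis"
    "HOL-Library.Landau_Symbols"
    "HOL-Library.Sublist"
    "Jordan_Normal_Form.Char_Poly"
begin

section \<open>Deterministic automata\<close>

text \<open>The alphabet is always the whole type \<open>'a :: {finite, linorder}\<close>.\<close>

record ('q, 'a) automaton =
  states :: "'q set"
  step :: "'q \<Rightarrow> 'a \<Rightarrow> 'q"
  start :: 'q
  finals :: "'q set"

definition deterministic_automaton :: "('q, 'a) automaton \<Rightarrow> bool" where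
  "deterministic_automaton M \<longleftrightarrow>
     finite (states M) \<and> start M \<in> states M \<and> finals M \<subseteq> states M \<and>
     (\<forall>q\<in>states M. \<forall>a. step M q a \<in> states M)"

definition run :: "('q, 'a) automaton \<Rightarrow> 'q \<Rightarrow> 'a list \<Rightarrow> 'q" where
  "run M q w = foldl (step M) q w"

definition language :: "('q, 'a) automaton \<Rightarrow> 'a list set" where
  "language M = {w. run M (start M) w \<in> finals M}"

definition totally_ordered_by :: "('q, 'a) automaton \<Rightarrow> ('q \<times> 'q) set \<Rightarrow> bool" where
  "totally_ordered_by M R \<longleftrightarrow>
     linear_order_on (states M) R \<and>
     (\<forall>q\<in>states M. \<forall>r\<in>states M. \<forall>a. (q, r) \<in> R \<longrightarrow> (step M q a, step M r a) \<in> R)"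

definition accessible :: "('q, 'a) automaton \<Rightarrow> 'q \<Rightarrow> bool" where
  "accessible M q \<longleftrightarrow> (\<exists>w. q = run M (start M) w)"

definition coaccessible :: "('q, 'a) automaton \<Rightarrow> 'q \<Rightarrow> bool" where
  "coaccessible M q \<longleftrightarrow> (\<exists>w. run M q w \<in> finals M)"

text \<open>
  The useful states are numbered in increasing order to obtain a matrix with indices
  \<open>0, \<dots>, n - 1\<close>; the characteristic polynomial does not depend on the numbering.
\<close>

definition incidence_matrix :: "('q::linorder, 'a) automaton \<Rightarrow> complex mat" where
  "incidence_matrix M =
     (let qs = sorted_list_of_set {q\<in>states M. accessible M q \<and> coaccessible M q};
          n = length qs
      in Matrix.mat n n (\<lambda>(i, j). of_nat (card {a. step M (qs ! i) a = qs ! j})))"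

text \<open>
  ``Simple'' refers to the algebraic multiplicity. The condition that the multiplicity is 1
  includes that \<open>\<beta>\<close> is an eigenvalue.
\<close>

definition pisot_automaton :: "('q::linorder, 'a) automaton \<Rightarrow> bool" where
  "pisot_automaton M \<longleftrightarrow>
     (\<exists>\<beta>::real. \<beta> > 1 \<and>
        Polynomial.order (complex_of_real \<beta>) (char_poly (incidence_matrix M)) = 1 \<and>
        (\<forall>\<alpha>. eigenvalue (incidence_matrix M) \<alpha> \<and> \<alpha> \<noteq> complex_of_real \<beta> \<longrightarrow> cmod \<alpha> < 1))"


section \<open>Abstract numeration systems\<close>

abbreviation shortlex :: "('a::linorder list \<times> 'a list) set" where
  "shortlex \<equiv> lenlex {(a, b). a < b}"

definition regular_language :: "'a list set \<Rightarrow> bool" where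
  "regular_language L \<longleftrightarrow>
     (\<exists>M :: (nat, 'a) automaton. deterministic_automaton M \<and> L = language M)"

definition numeration_system :: "'a::{finite,linorder} list set \<Rightarrow> bool" where
  "numeration_system L \<longleftrightarrow> infinite L \<and> regular_language L"

definition val :: "'a::{finite,linorder} list set \<Rightarrow> 'a list \<Rightarrow> nat" where
  "val L w = card {v\<in>L. (v, w) \<in> shortlex}"

definition rep :: "'a::{finite,linorder} list set \<Rightarrow> nat \<Rightarrow> 'a list" where
  "rep L n = (THE w. w \<in> L \<and> val L w = n)"


section \<open>Normalized values\<close>

definition num_upto :: "'a list set \<Rightarrow> nat \<Rightarrow> nat" where
  "num_upto L k = card {v\<in>L. length v \<le> k}"

definition has_growth_base :: "'a list set \<Rightarrow> real \<Rightarrow> bool" where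
  "has_growth_base L \<beta> \<longleftrightarrow>
     \<beta> > 1 \<and> (\<lambda>k. 1 / real k * ln (real (num_upto L k))) \<longlonglongrightarrow> ln \<beta>"

definition exponential_growth :: "'a list set \<Rightarrow> bool" where
  "exponential_growth L \<longleftrightarrow> (\<exists>\<beta>. has_growth_base L \<beta>)"

definition growth_base :: "'a list set \<Rightarrow> real" where
  "growth_base L = (THE \<beta>. has_growth_base L \<beta>)"

text \<open>Right-infinite words are functions \<open>nat \<Rightarrow> 'a\<close>.\<close>

definition omega_prefix :: "'a list \<Rightarrow> (nat \<Rightarrow> 'a) \<Rightarrow> bool" where
  "omega_prefix w u \<longleftrightarrow> w = map u [0..<length w]"

definition omega_less :: "(nat \<Rightarrow> 'a::linorder) \<Rightarrow> (nat \<Rightarrow> 'a) \<Rightarrow> bool" where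
  "omega_less u v \<longleftrightarrow> (\<exists>n. (\<forall>i<n. u i = v i) \<and> u n < v n)"

definition word_limit :: "(nat \<Rightarrow> 'a list) \<Rightarrow> (nat \<Rightarrow> 'a) \<Rightarrow> bool" where
  "word_limit w u \<longleftrightarrow> (\<forall>p. omega_prefix p u \<longrightarrow> finite {k. \<not> prefix p (w k)})"

definition omega_language :: "'a list set \<Rightarrow> (nat \<Rightarrow> 'a) set" where
  "omega_language L = {u. \<exists>w. (\<forall>k. w k \<in> L) \<and> word_limit w u}"

definition has_val_omega :: "'a::{finite,linorder} list set \<Rightarrow> (nat \<Rightarrow> 'a) \<Rightarrow> real \<Rightarrow> bool" where
  "has_val_omega L u x \<longleftrightarrow>
     u \<in> omega_language L \<and>
     (\<forall>w. (\<forall>k. w k \<in> L) \<and> word_limit w u \<longrightarrow>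
        (\<lambda>k. real (val L (w k)) / real (num_upto L (length (w k)))) \<longlonglongrightarrow> x)"

definition val_omega :: "'a::{finite,linorder} list set \<Rightarrow> (nat \<Rightarrow> 'a) \<Rightarrow> real" where
  "val_omega L u = (THE x. has_val_omega L u x)"

definition norm_val_omega :: "'a::{finite,linorder} list set \<Rightarrow> (nat \<Rightarrow> 'a) \<Rightarrow> real" where
  "norm_val_omega L u = (growth_base L * val_omega L u - 1) / (growth_base L - 1)"

definition least_extension :: "'a::{finite,linorder} list set \<Rightarrow> 'a list \<Rightarrow> (nat \<Rightarrow> 'a)" where
  "least_extension L w =
     (THE u. u \<in> omega_language L \<and> omega_prefix w u \<and>
        (\<forall>v\<in>omega_language L. omega_prefix w v \<longrightarrow> u = v \<or> omega_less u v))"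

definition norm_val :: "'a::{finite,linorder} list set \<Rightarrow> 'a list \<Rightarrow> real" where
  "norm_val L w = norm_val_omega L (least_extension L w)"


section \<open>Abstract van der Corput sequences\<close>

definition van_der_corput_defined :: "'a::{finite,linorder} list set \<Rightarrow> bool" where
  "van_der_corput_defined L \<longleftrightarrow>
     exponential_growth L \<and>
     (\<forall>w\<in>L. \<exists>u\<in>omega_language L. omega_prefix w u) \<and>
     (\<forall>u\<in>omega_language L. \<exists>x. has_val_omega L u x)"

definition reduced_language :: "'a::{finite,linorder} list set \<Rightarrow> 'a list set" where
  "reduced_language L =
     {w\<in>L. \<forall>v\<in>L. (v, w) \<in> shortlex \<longrightarrow> norm_val L w \<noteq> norm_val L v}"

definition van_der_corput :: "'a::{finite,linorder} list set \<Rightarrow> nat \<Rightarrow> real" where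
  "van_der_corput L n = norm_val L (rev (rep (rev ` reduced_language L) n))"


section \<open>Discrepancy\<close>

definition discrepancy :: "(nat \<Rightarrow> real) \<Rightarrow> nat \<Rightarrow> real set \<Rightarrow> real" where
  "discrepancy x N I = real (card {n. n < N \<and> x n \<in> I}) - real N * measure lborel I"

text \<open>
  The supremum is one of real numbers; it is over a nonempty set bounded above by \<open>N\<close>.
\<close>

definition low_discrepancy :: "(nat \<Rightarrow> real) \<Rightarrow> bool" where
  "low_discrepancy x \<longleftrightarrow>
     (\<lambda>N. SUP I\<in>{I. is_interval I \<and> I \<subseteq> {0..<1}}. discrepancy x N I) \<in> O(\<lambda>N. ln (real N))"

end

theory Submission
  imports
    Defs
    "Jordan_Normal_Form.Schur_Decomposition"
    "HOL-Real_Asymp.Real_Asymp"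
begin

text \<open>
  Let \<open>\<eta>\<close> be the positive right eigenvector of the incidence matrix for \<open>\<beta>\<close>, normalized by
  \<open>\<eta> d = 1\<close>. The normalized value of a word is the left endpoint of the interval it receives when
  \<open>[0, 1)\<close> is subdivided along the automaton, a node \<open>w\<close> getting length
  \<open>\<eta> (\<tau> d w) / \<beta> ^ length w\<close>. Hence exactly the words ending in the minimal letter are dropped
  in the reduced language, and the first \<open>N\<close> points are, up to padding with the minimal letter, the
  values of the words of one length whose mirror image lies below that of the \<open>N\<close>-th word \<open>z\<close>.
  Branching off from \<open>z\<close> letter by letter splits them into \<open>O (length z) = O (ln N)\<close> blocks of
  words \<open>u @ s\<close> with a fixed suffix \<open>s\<close> and \<open>u\<close> of fixed length. In a block, \<open>u\<close> ranges over the
  words leading into a set \<open>T\<close> of states. Since all eigenvalues other than \<open>\<beta>\<close> lie inside the unit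
  disk, the number of words of length \<open>m\<close> from \<open>q\<close> into \<open>T\<close> is \<open>\<kappa> T * \<eta> q * \<beta> ^ m\<close> up to an
  error that is summable in \<open>m\<close>, so every block has bounded discrepancy.
\<close>

section \<open>Powers of a matrix with a dominant simple eigenvalue\<close>

text \<open>Summing the recurrence bounds the partial sum \<open>S\<close> of the norms by
  \<open>cmod (t 0) + cmod a * S\<close> plus the total of \<open>u\<close>; since
  \<open>cmod a < 1\<close>, this can be solved for \<open>S\<close>.\<close>

lemma summable_norm_linear_recurrence:
  fixes t u :: "nat \<Rightarrow> complex"
  assumes rec: "\<And>m. t (Suc m) = a * t m + u m" and a: "cmod a < 1"
    and u: "summable (\<lambda>m. cmod (u m))"
  shows "summable (\<lambda>m. cmod (t m))"
proof (rule summableI_nonneg_bounded)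
  define C where "C = (cmod (t 0) + suminf (\<lambda>m. cmod (u m))) / (1 - cmod a)"
  show "(\<Sum>m<n. cmod (t m)) \<le> C" for n
  proof -
    have "(\<Sum>m<n. cmod (t m)) \<le> (\<Sum>m<Suc n. cmod (t m))" by simp
    also have "\<dots> = cmod (t 0) + (\<Sum>m<n. cmod (a * t m + u m))"
      by (subst sum.lessThan_Suc_shift) (simp add: rec)
    also have "\<dots> \<le> cmod (t 0) + (\<Sum>m<n. cmod a * cmod (t m) + cmod (u m))"
      by (intro add_left_mono sum_mono) (metis norm_mult norm_triangle_ineq)
    also have "\<dots> = cmod (t 0) + cmod a * (\<Sum>m<n. cmod (t m)) + (\<Sum>m<n. cmod (u m))"
      by (simp add: sum.distrib sum_distrib_left)
    also have "(\<Sum>m<n. cmod (u m)) \<le> suminf (\<lambda>m. cmod (u m))"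
      by (rule sum_le_suminf[OF u]) auto
    finally have "(1 - cmod a) * (\<Sum>m<n. cmod (t m)) \<le> cmod (t 0) + suminf (\<lambda>m. cmod (u m))"
      by (simp add: algebra_simps)
    then show ?thesis using a by (simp add: C_def field_simps)
  qed
qed simp

text \<open>Discounting all future inputs to time \<open>m\<close> gives \<open>U m\<close> with
  \<open>b * U m = u m + U (Suc m)\<close>. Hence \<open>t + U\<close> obeys the recurrence without
  input and equals \<open>H * b ^ m\<close>; the deviation \<open>- U m\<close> is summable.\<close>

lemma dominant_linear_recurrence:
  fixes t u :: "nat \<Rightarrow> complex"
  assumes rec: "\<And>m. t (Suc m) = b * t m + u m" and b: "cmod b > 1"
    and u: "summable (\<lambda>m. cmod (u m))"
  obtains H where "summable (\<lambda>m. cmod (t m - H * b ^ m))"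
proof -
  define U where "U m = (\<Sum>i. u (i + m) / b ^ Suc i)" for m
  have b0: "b \<noteq> 0" using b by auto
  have su: "summable (\<lambda>i. cmod (u (i + m)))" for m
    using u by (subst summable_iff_shift)
  have ub: "cmod (u (i + m) / b ^ Suc i) \<le> cmod (u (i + m))" for i m
  proof -
    have "1 \<le> cmod b ^ Suc i" using b by (intro one_le_power) auto
    then show ?thesis 
      by (simp add: norm_divide norm_power norm_mult divide_le_eq mult_le_cancel_left1 del: power_Suc)
  qed
  have sU: "summable (\<lambda>i. u (i + m) / b ^ Suc i)" for m
    by (rule summable_comparison_test'[OF su[of m], of 0]) (use ub in simp)
  have Urec: "U m = u m / b + U (Suc m) / b" for m
  proof -
    have "U m = u m / b + (\<Sum>i. u (Suc i + m) / b ^ Suc (Suc i))"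
      unfolding U_def using suminf_split_head[OF sU[of m]] by simp
    also have "(\<Sum>i. u (Suc i + m) / b ^ Suc (Suc i)) = (\<Sum>i. (u (i + Suc m) / b ^ Suc i) / b)"
      by (intro suminf_cong) (simp add: field_simps)
    also have "\<dots> = U (Suc m) / b"
      unfolding U_def by (rule suminf_divide[OF sU[of "Suc m"]])
    finally show ?thesis .
  qed
  define H where "H = t 0 + U 0"
  have eq: "t m + U m = H * b ^ m" for m
  proof (induction m)
    case (Suc m)
    have "b * U m = u m + U (Suc m)" using Urec[of m] b0 by (simp add: field_simps)
    then have "t (Suc m) + U (Suc m) = b * (t m + U m)" by (simp add: rec algebra_simps)
    with Suc show ?case by simp
  qed (simp add: H_def)
  have "summable (\<lambda>m. cmod (U m))"
  proof -
    show ?thesis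
    proof (rule summableI_nonneg_bounded)
      define r where "r = inverse (cmod b)"
      have r: "0 < r" "r < 1" using b by (auto simp: r_def inverse_less_1_iff)
      have bound0: "cmod (U n) \<le> suminf (\<lambda>m. cmod (u m))" for n
      proof -
        have "cmod (U n) \<le> (\<Sum>i. cmod (u (i + n)))"
          unfolding U_def
          by (rule norm_suminf_le[OF ub su])
        also have "\<dots> \<le> suminf (\<lambda>m. cmod (u m))"
          using suminf_split_initial_segment[OF u, of n] sum_nonneg[of "{..<n}" "\<lambda>i. cmod (u i)"] by simp
        finally show ?thesis .
      qed
      define B where "B = suminf (\<lambda>m. cmod (u m))"
      \<comment> \<open>With \<open>S\<close> the partial sum, the recurrence of \<open>U\<close>
        yields \<open>S \<le> r * B + r * (S + B)\<close>: the index shift costs at most one last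
        term, itself bounded by \<open>B\<close>.\<close>
      show "(\<Sum>m<n. cmod (U m)) \<le> (2 * B * r) / (1 - r)" for n
      proof -
        have "(\<Sum>m<n. cmod (U m)) \<le> (\<Sum>m<n. r * cmod (u m) + r * cmod (U (Suc m)))"
        proof (rule sum_mono)
          fix m
          have "cmod (U m) \<le> cmod (u m / b) + cmod (U (Suc m) / b)"
            by (subst Urec) (rule norm_triangle_ineq)
          then show "cmod (U m) \<le> r * cmod (u m) + r * cmod (U (Suc m))"
            by (simp add: norm_divide r_def field_simps)
        qed
        also have "\<dots> = r * (\<Sum>m<n. cmod (u m)) + r * (\<Sum>m<n. cmod (U (Suc m)))"
          by (simp add: sum.distrib sum_distrib_left)
        also have "(\<Sum>m<n. cmod (U (Suc m))) \<le> (\<Sum>m<n. cmod (U m)) + cmod (U n)"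
          using sum.lessThan_Suc_shift[of "\<lambda>m. cmod (U m)" n] by simp
        also have "cmod (U n) \<le> B" using bound0 by (simp add: B_def)
        also have "(\<Sum>m<n. cmod (u m)) \<le> B" unfolding B_def
          by (rule sum_le_suminf[OF u]) auto
        finally have "(\<Sum>m<n. cmod (U m)) \<le> r * B + r * ((\<Sum>m<n. cmod (U m)) + B)"
          using r by (simp add: mult_left_mono)
        then show ?thesis using r by (simp add: field_simps)
      qed
    qed simp
  qed
  moreover have "cmod (t m - H * b ^ m) = cmod (U m)" for m
    using eq[of m] by (metis add_diff_cancel_left' norm_minus_commute)
  ultimately have "summable (\<lambda>m. cmod (t m - H * b ^ m))" by simp
  then show thesis by (rule that)
qed

text \<open>
  Triangularize with \<open>b\<close> as the first diagonal entry: as \<open>b\<close> is simple, all coordinates of an orbit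
  but the first are summable, which makes the leading coefficient a product of a factor depending on
  the coordinate and one depending on the orbit.
\<close>

lemma dominant_eigenvalue_asymptotics:
  fixes A :: "complex mat"
  assumes A: "A \<in> carrier_mat n n"
    and simple: "Polynomial.order b (char_poly A) = 1" and b: "cmod b > 1"
    and small: "\<And>a. eigenvalue A a \<Longrightarrow> a \<noteq> b \<Longrightarrow> cmod a < 1"
  shows "\<exists>p :: nat \<Rightarrow> complex. \<forall>v :: nat \<Rightarrow> nat \<Rightarrow> complex.
       (\<forall>m. \<forall>i<n. v (Suc m) i = (\<Sum>j<n. A $$ (i, j) * v m j)) \<longrightarrow>
       (\<exists>H. \<forall>i<n. summable (\<lambda>m. cmod (v m i - p i * H * b ^ m)))"
proof -
  have cp0: "char_poly A \<noteq> 0" using degree_monic_char_poly[OF A] by auto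
  obtain es0 where es0: "char_poly A = (\<Prod>a\<leftarrow>es0. [:- a, 1:])"
    using char_poly_factorized[OF A] by blast
  have root: "eigenvalue A a \<longleftrightarrow> a \<in> set es0" for a
    unfolding eigenvalue_root_char_poly[OF A] es0 
    by (simp add: poly_prod_list_zero_iff image_iff)
  have "eigenvalue A b" unfolding eigenvalue_root_char_poly[OF A]
    using simple cp0 by (simp add: order_root)
  then have "b \<in> set es0" using root by simp
  then obtain xs ys where xy: "es0 = xs @ b # ys" by (meson split_list)
  define es where "es = xs @ ys"
  have cp: "char_poly A = (\<Prod>a\<leftarrow>b # es. [:- a, 1:])"
    unfolding es0 xy es_def
    by (simp only: map_append list.map prod_list.append prod_list.Cons mult.left_commute)
  \<comment> \<open>A second occurrence of \<open>b\<close> would make the square of its linear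
    factor divide the characteristic polynomial.\<close>
  have nb: "b \<notin> set es"
  proof
    assume "b \<in> set es"
    then have "poly (\<Prod>a\<leftarrow>es. [:- a, 1:]) b = 0"
      by (simp add: poly_prod_list_zero_iff image_iff)
    then have "[:- b, 1:] dvd (\<Prod>a\<leftarrow>es. [:- a, 1:])" by (simp add: poly_eq_0_iff_dvd)
    then have "[:- b, 1:] ^ 2 dvd char_poly A"
      unfolding cp power2_eq_square list.map prod_list.Cons
      by (rule mult_dvd_mono[OF dvd_refl])
    then have "2 \<le> Polynomial.order b (char_poly A)" using cp0 by (simp add: order_divides)
    with simple show False by simp
  qed
  have smalles: "cmod a < 1" if "a \<in> set es" for a
    using that nb root[of a] small[of a] by (auto simp: xy es_def)
  obtain B P Q where schur: "schur_decomposition A (b # es) = (B, P, Q)"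
    by (cases "schur_decomposition A (b # es)") auto
  have sim: "similar_mat_wit A B P Q" and up: "upper_triangular B" and dg: "diag_mat B = b # es"
    using schur_decomposition[OF A cp schur] by auto
  note w = similar_mat_witD2[OF A sim]
  have n: "n = Suc (length es)" using arg_cong[OF dg, of length] w(5) by (simp add: diag_mat_def)
  have Bdiag: "B $$ (i, i) = (b # es) ! i" if "i < n" for i
    using that w(5) dg[symmetric] by (simp add: diag_mat_def)
  have B0: "B $$ (i, j) = 0" if "j < i" "i < n" for i j
    using up that w(5) by (auto simp: upper_triangular_def)
  \<comment> \<open>The witness is the first column of \<open>P\<close>, an eigenvector for
    \<open>b\<close> because \<open>B\<close> is upper triangular; it is fixed before the orbit
    \<open>v\<close> is chosen.\<close>
  show ?thesis
  proof (intro exI[of _ "\<lambda>i. P $$ (i, 0)"] allI impI)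
    fix v :: "nat \<Rightarrow> nat \<Rightarrow> complex"
    assume v: "\<forall>m. \<forall>i<n. v (Suc m) i = (\<Sum>j<n. A $$ (i, j) * v m j)"
    define vv where "vv m = Matrix.vec n (v m)" for m
    have vvc: "vv m \<in> carrier_vec n" for m by (simp add: vv_def)
    have mv: "vec_index (X *\<^sub>v y) i = (\<Sum>j<n. X $$ (i, j) * vec_index y j)" 
      if "X \<in> carrier_mat n n" "y \<in> carrier_vec n" "i < n" for X y i
      using that by (simp add: scalar_prod_def lessThan_atLeast0)
    have vrec: "vv (Suc m) = A *\<^sub>v vv m" for m
    proof (rule eq_vecI)
      fix i assume "i < dim_vec (A *\<^sub>v vv m)"
      then have i: "i < n" using A by simp
      show "vec_index (vv (Suc m)) i = vec_index (A *\<^sub>v vv m) i"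
        unfolding mv[OF A vvc i] using i by (simp add: vv_def v)
    qed (use A in \<open>simp add: vv_def\<close>)
    define y where "y m = Q *\<^sub>v vv m" for m
    have yc: "y m \<in> carrier_vec n" for m using w(7) vvc by (simp add: y_def)
    have yrec: "y (Suc m) = B *\<^sub>v y m" for m
    proof -
      have "y (Suc m) = Q *\<^sub>v ((P * B * Q) *\<^sub>v vv m)" by (simp add: y_def vrec w(3)[symmetric])
      also have "\<dots> = (Q * (P * B * Q)) *\<^sub>v vv m"
        by (rule assoc_mult_mat_vec[symmetric]) (use w(4-7) vvc in auto)
      also have "Q * (P * B * Q) = (Q * P) * B * Q"
        using assoc_mult_mat[OF w(7) mult_carrier_mat[OF w(6,5)] w(7)] assoc_mult_mat[OF w(7,6,5)]
        by simp
      also have "\<dots> = B * Q" using w(2,5) by simp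
      also have "\<dots> *\<^sub>v vv m = B *\<^sub>v y m" unfolding y_def
        by (rule assoc_mult_mat_vec) (use w(4-7) vvc in auto)
      finally show ?thesis .
    qed
    have vy: "vv m = P *\<^sub>v y m" for m
    proof -
      have "P *\<^sub>v y m = (P * Q) *\<^sub>v vv m" unfolding y_def
        by (rule assoc_mult_mat_vec[symmetric]) (use w(4-7) vvc in auto)
      then show ?thesis using w(1) vvc by simp
    qed
    have yi: "vec_index (y (Suc m)) i = B $$ (i, i) * vec_index (y m) i + 
        (\<Sum>j\<in>{i<..<n}. B $$ (i, j) * vec_index (y m) j)" if "i < n" for m i
    proof -
      have "vec_index (y (Suc m)) i = (\<Sum>j<n. B $$ (i, j) * vec_index (y m) j)"
        unfolding yrec by (rule mv[OF w(5) yc that])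
      also have "\<dots> = (\<Sum>j\<in>insert i {i<..<n}. B $$ (i, j) * vec_index (y m) j)"
        by (rule sum.mono_neutral_right) (use that B0 in \<open>auto simp: not_less_iff_gr_or_eq\<close>)
      finally show ?thesis by simp
    qed
    \<comment> \<open>Back substitution: the input of coordinate \<open>i\<close> consists of the
      coordinates \<open>j > i\<close>, so the induction runs from the last coordinate down to
      1.\<close>
    have sy: "summable (\<lambda>m. cmod (vec_index (y m) i))" if "i < n" "i > 0" for i
      using that
    proof (induction "n - i" arbitrary: i rule: less_induct)
      case less
      show ?case
      proof (rule summable_norm_linear_recurrence)
        show "vec_index (y (Suc m)) i = B $$ (i, i) * vec_index (y m) i +
            (\<Sum>j\<in>{i<..<n}. B $$ (i, j) * vec_index (y m) j)" for m
          by (rule yi[OF less.prems(1)])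
        show "cmod (B $$ (i, i)) < 1" using less.prems n
          by (subst Bdiag) (auto simp: nth_Cons' intro!: smalles)
        have "summable (\<lambda>m. \<Sum>j\<in>{i<..<n}. cmod (B $$ (i, j)) * cmod (vec_index (y m) j))"
          by (intro summable_sum summable_mult less.hyps) auto
        then show "summable (\<lambda>m. cmod (\<Sum>j\<in>{i<..<n}. B $$ (i, j) * vec_index (y m) j))"
          by (rule summable_comparison_test'[of _ 0])
            (auto simp: norm_mult intro!: order_trans[OF norm_sum])
      qed
    qed
    have "summable (\<lambda>m. \<Sum>j\<in>{0<..<n}. cmod (B $$ (0, j)) * cmod (vec_index (y m) j))"
      by (intro summable_sum summable_mult sy) auto
    then have s0: "summable (\<lambda>m. cmod (\<Sum>j\<in>{0<..<n}. B $$ (0, j) * vec_index (y m) j))"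
      by (rule summable_comparison_test'[of _ 0])
        (auto simp: norm_mult intro!: order_trans[OF norm_sum])
    \<comment> \<open>The first coordinate has diagonal entry \<open>b\<close> and summable input,
      so it alone carries the leading term.\<close>
    have y0: "vec_index (y (Suc m)) 0 = b * vec_index (y m) 0 + 
       (\<Sum>j\<in>{0<..<n}. B $$ (0, j) * vec_index (y m) j)" for m
      using yi[of 0 m] Bdiag[of 0] n by simp
    obtain H where H: "summable (\<lambda>m. cmod (vec_index (y m) 0 - H * b ^ m))"
      using dominant_linear_recurrence[where t = "\<lambda>m. vec_index (y m) 0", OF y0 b s0] by blast
    show "\<exists>H. \<forall>i<n. summable (\<lambda>m. cmod (v m i - P $$ (i, 0) * H * b ^ m))"
    proof (intro exI allI impI)
      fix i assume i: "i < n"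
      define z where "z m = cmod (P $$ (i,0)) * cmod (vec_index (y m) 0 - H * b ^ m) + 
         (\<Sum>j\<in>{0<..<n}. cmod (P $$ (i,j)) * cmod (vec_index (y m) j))" for m
      have "summable z" unfolding z_def
        by (intro summable_add summable_sum summable_mult sy H) auto
      then show "summable (\<lambda>m. cmod (v m i - P $$ (i, 0) * H * b ^ m))"
      proof (rule summable_comparison_test'[of _ 0])
        fix m
        have "v m i = vec_index (vv m) i" using i by (simp add: vv_def)
        also have "\<dots> = (\<Sum>j<n. P $$ (i, j) * vec_index (y m) j)"
          unfolding vy[of m] by (rule mv[OF w(6) yc i])
        also have "{..<n} = insert 0 {0<..<n}" using n by auto
        finally have "v m i - P $$ (i, 0) * H * b ^ m = P $$ (i, 0) * (vec_index (y m) 0 - H * b ^ m)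
            + (\<Sum>j\<in>{0<..<n}. P $$ (i, j) * vec_index (y m) j)"
          by (simp add: algebra_simps)
        also have "cmod \<dots> \<le> z m" unfolding z_def
          by (rule norm_triangle_le) (auto simp: norm_mult intro!: add_mono order_trans[OF norm_sum])
        finally show "norm (cmod (v m i - P $$ (i, 0) * H * b ^ m)) \<le> z m" by simp
      qed
    qed
  qed
qed

section \<open>Words and the shortlex order\<close>

abbreviation letter_order :: "('a::linorder \<times> 'a) set" where
  "letter_order \<equiv> {(a, b). a < b}"

lemma finite_words_length [simp]: "finite {u :: 'a::finite list. length u = m}"
  using finite_lists_length_eq[of "UNIV :: 'a set" m] by simp

lemma finite_words_lex [simp]: "finite {u :: 'a::finite list. (u, w) \<in> lex r}"
  by (rule finite_subset[OF _ finite_words_length[of "length w"]]) (auto simp: lex_conv)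

lemma lex_length_eq: "(u, v) \<in> lex r \<Longrightarrow> length u = length v"
  by (auto simp: lex_conv)

lemma lex_letter_order_total:
  assumes "length u = length (v :: 'a::linorder list)"
  shows "u = v \<or> (u, v) \<in> lex letter_order \<or> (v, u) \<in> lex letter_order"
  using assms by (induction u v rule: list_induct2) auto

section \<open>Counting words by the state they lead to\<close>

definition path_count :: "('q \<Rightarrow> 'a \<Rightarrow> 'q) \<Rightarrow> 'q \<Rightarrow> 'q set \<Rightarrow> nat \<Rightarrow> nat" where
  "path_count \<tau> q T m = card {u. length u = m \<and> foldl \<tau> q u \<in> T}"

text \<open>Splitting off the first letter makes the counts, indexed by the source state, an orbit
  of the transition matrix.\<close>

lemma path_count_Suc:
  fixes \<tau> :: "'q \<Rightarrow> 'a::finite \<Rightarrow> 'q"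
  shows "path_count \<tau> q T (Suc m) = (\<Sum>a\<in>UNIV. path_count \<tau> (\<tau> q a) T m)"
proof -
  have "{u. length u = Suc m \<and> foldl \<tau> q u \<in> T} =
      (\<Union>a. (#) a ` {u. length u = m \<and> foldl \<tau> (\<tau> q a) u \<in> T})"
    by (auto simp: length_Suc_conv image_iff)
  also have "card \<dots> = (\<Sum>a\<in>UNIV. card ((#) a ` {u. length u = m \<and> foldl \<tau> (\<tau> q a) u \<in> T}))"
    by (rule card_UN_disjoint) (auto intro!: finite_imageI finite_subset[OF _ finite_words_length[of m]])
  also have "\<dots> = (\<Sum>a\<in>UNIV. path_count \<tau> (\<tau> q a) T m)"
    unfolding path_count_def by (intro sum.cong refl card_image) auto
  finally show ?thesis unfolding path_count_def .
qed

section \<open>The shortlex order and the enumeration of a language\<close>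

lemma shortlex_total: "u = v \<or> (u, v) \<in> shortlex \<or> (v, u) \<in> shortlex"
  using lex_letter_order_total[of u v] by (auto simp: lenlex_conv)

lemma shortlex_irrefl: "(u, u) \<notin> shortlex"
  by (rule lenlex_irreflexive) simp

lemma shortlex_trans: "(u, v) \<in> shortlex \<Longrightarrow> (v, w) \<in> shortlex \<Longrightarrow> (u, w) \<in> shortlex"
  by (rule lenlex_trans) (auto simp: trans_def)

lemma finite_shortlex_below: "finite {v :: 'a::{finite,linorder} list. (v, w) \<in> shortlex}"
  by (rule finite_subset[OF _ finite_lists_length_le[of UNIV "length w"]]) (auto dest: lenlex_length)

lemma val_less_iff:
  fixes R :: "'a::{finite,linorder} list set"
  assumes "v \<in> R" "w \<in> R"
  shows "val R v < val R w \<longleftrightarrow> (v, w) \<in> shortlex"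
proof -
  have *: "val R x < val R y" if "x \<in> R" "(x, y) \<in> shortlex" for x y
    unfolding val_def
  proof (rule psubset_card_mono)
    show "finite {v \<in> R. (v, y) \<in> shortlex}"
      by (rule finite_subset[OF _ finite_shortlex_below[of y]]) auto
    show "{v \<in> R. (v, x) \<in> shortlex} \<subset> {v \<in> R. (v, y) \<in> shortlex}"
      using that shortlex_irrefl[of x] shortlex_trans by blast
  qed
  show ?thesis using *[of v w] *[of w v] assms shortlex_total[of v w] by fastforce
qed

text \<open>For surjectivity, infinitely many values leave some \<open>w\<close> with
  \<open>n < val R w\<close>. Its \<open>val R w\<close> predecessors have distinct values below
  \<open>val R w\<close>, hence attain all of them.\<close>

lemma val_bij_betw:
  fixes R :: "'a::{finite,linorder} list set"
  assumes "infinite R"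
  shows "bij_betw (val R) R UNIV"
proof -
  have inj: "inj_on (val R) R"
    by (rule inj_onI) (metis order_less_irrefl shortlex_total val_less_iff)
  have "n \<in> val R ` R" for n
  proof -
    have "infinite (val R ` R)" using assms inj finite_imageD by blast
    then obtain w where w: "w \<in> R" "n < val R w"
      by (metis (mono_tags, lifting) finite_nat_set_iff_bounded_le imageE not_le)
    let ?B = "{v \<in> R. (v, w) \<in> shortlex}"
    have "val R ` ?B \<subseteq> {..<val R w}" using w val_less_iff by blast
    moreover have "card (val R ` ?B) = card {..<val R w}"
      by (subst card_image) (auto intro: inj_on_subset[OF inj] simp: val_def)
    ultimately have "val R ` ?B = {..<val R w}" by (intro card_subset_eq) auto
    then show ?thesis using w(2) by blast
  qed
  then show ?thesis using inj by (auto simp: bij_betw_def)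
qed

lemma rep_mem:
  assumes "infinite R"
  shows "rep R n \<in> R" "val R (rep R n) = n"
proof -
  have "\<exists>!w. w \<in> R \<and> val R w = n"
    using val_bij_betw[OF assms] by (auto simp: bij_betw_def inj_on_def image_iff) (metis UNIV_I imageE)
  from theI'[OF this] show "rep R n \<in> R" "val R (rep R n) = n" by (auto simp: rep_def)
qed

text \<open>This replaces the first \<open>N\<close> indices by the words preceding the
  \<open>N\<close>-th word.\<close>

lemma rep_image_lessThan:
  assumes "infinite R"
  shows "rep R ` {..<N} = {v \<in> R. (v, rep R N) \<in> shortlex}"
proof (intro Set.equalityI subsetI)
  fix v assume "v \<in> rep R ` {..<N}"
  then show "v \<in> {v \<in> R. (v, rep R N) \<in> shortlex}"
    using rep_mem[OF assms] val_less_iff[of v R "rep R N"] by auto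
next
  fix v assume v: "v \<in> {v \<in> R. (v, rep R N) \<in> shortlex}"
  then have "val R v < N" using rep_mem[OF assms] val_less_iff[of v R "rep R N"] by auto
  moreover have "rep R (val R v) = v"
    using v rep_mem[OF assms, of "val R v"] val_bij_betw[OF assms] by (auto simp: bij_betw_def inj_on_def)
  ultimately show "v \<in> rep R ` {..<N}" by (metis imageI lessThan_iff)
qed

lemma inj_rep: "infinite R \<Longrightarrow> inj (rep R)"
  by (rule inj_on_inverseI[of _ "val R"]) (simp add: rep_mem)

section \<open>Lengths of subintervals of the unit interval\<close>

lemma interval_length_le_measure:
  fixes I :: "real set"
  assumes I: "is_interval I" "I \<subseteq> {0..<1}" and pq: "p \<in> I" "q \<in> I"
  shows "q - p \<le> measure lborel I"
proof (cases "p \<le> q")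
  case True
  have sub: "{p..q} \<subseteq> I" using mem_is_interval_1_I[OF I(1) pq] by auto
  have "emeasure lborel I \<le> emeasure lborel {0..1::real}"
    by (rule emeasure_mono) (use I(2) in auto)
  then have fin: "I \<in> fmeasurable lborel"
    using real_interval_borel_measurable[OF I(1)]
    by (intro fmeasurableI) (auto simp: le_less_trans)
  have "measure lborel {p..q} \<le> measure lborel I"
    by (rule measure_mono_fmeasurable[OF sub _ fin]) simp
  then show ?thesis using True by simp
qed (use measure_nonneg[of lborel I] in linarith)

lemma measure_le_1:
  fixes I :: "real set"
  assumes "I \<subseteq> {0..<1}"
  shows "measure lborel I \<le> 1"
proof -
  have "measure lborel I \<le> measure lborel {0..1::real}"
  proof (cases "I \<in> sets lborel")
    case True
    show ?thesis by (rule measure_mono_fmeasurable[OF _ True]) (use assms in \<open>auto intro!: fmeasurableI\<close>)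
  \<comment> \<open>On a set outside the sigma-algebra \<open>measure\<close> takes the default
    value 0.\<close>
  qed (simp add: measure_notin_sets)
  then show ?thesis by simp
qed

section \<open>The tree of words and its intervals\<close>

text \<open>\<open>Q\<close> stands for the useful states and 0 for the absorbing sink, where
  \<open>\<eta>\<close> is set to 0. The Pisot property enters through \<open>asymptotics\<close>,
  whose main term splits into a factor for the target set and one for the source; that
  \<open>\<eta>\<close> is an eigenvector is recovered from it in \<open>eigen\<close>.\<close>

locale pisot_tree =
  fixes \<tau> :: "nat \<Rightarrow> 'a::{finite,linorder} \<Rightarrow> nat"
    and Q :: "nat set" and d :: nat
    and \<beta> :: real and \<eta> :: "nat \<Rightarrow> real" and \<kappa> :: "nat set \<Rightarrow> real"
  assumes finite_Q: "finite Q" and d_Q: "d \<in> Q" and zero_Q: "0 \<notin> Q"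
    and step_Q: "\<And>q a. q \<in> Q \<Longrightarrow> \<tau> q a \<in> insert 0 Q"
    and step_0: "\<And>a. \<tau> 0 a = 0"
    and step_Min: "\<And>q. q \<in> Q \<Longrightarrow> \<tau> q (Min UNIV) \<noteq> 0"
    and \<beta>_gt_1: "\<beta> > 1"
    and \<eta>_d: "\<eta> d = 1" and \<eta>_0: "\<eta> 0 = 0" and \<eta>_pos: "\<And>q. q \<in> Q \<Longrightarrow> \<eta> q > 0"
    and asymptotics: "\<And>q T. q \<in> Q \<Longrightarrow> T \<subseteq> Q \<Longrightarrow>
      summable (\<lambda>m. \<bar>real (path_count \<tau> q T m) - \<kappa> T * \<eta> q * \<beta> ^ m\<bar>)"
begin

abbreviation a0 :: 'a where "a0 \<equiv> Min UNIV"

abbreviation num :: "nat \<Rightarrow> nat set \<Rightarrow> nat \<Rightarrow> nat" where "num \<equiv> path_count \<tau>"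

text \<open>The finite counterpart of \<open>V\<close>: for \<open>T \<subseteq> Q\<close> it stays
  within a constant of \<open>\<kappa> T * \<beta> ^ length w * V q w\<close>.\<close>

definition below :: "nat \<Rightarrow> nat set \<Rightarrow> 'a list \<Rightarrow> nat" where
  "below q T w = card {u. (u, w) \<in> lex letter_order \<and> foldl \<tau> q u \<in> T}"

text \<open>Summing over all sources and all target sets gives one summable sequence that dominates
  every counting error at once.\<close>

definition err :: "nat \<Rightarrow> real" where
  "err m = (\<Sum>q\<in>Q. \<Sum>T\<in>Pow Q. \<bar>real (num q T m) - \<kappa> T * \<eta> q * \<beta> ^ m\<bar>)"

text \<open>At most \<open>CARD('a)\<close> smaller letters branch off at each position of a word,
  so this bounds the errors of all branches along a word of any length.\<close>

definition count_error :: real where "count_error = real CARD('a) * suminf err"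

text \<open>\<open>V q w\<close> is the left endpoint of the part of \<open>[0, \<eta> q)\<close> that belongs to the node \<open>w\<close> below \<open>q\<close>.\<close>

primrec V :: "nat \<Rightarrow> 'a list \<Rightarrow> real" where
  "V q [] = 0"
| "V q (a # w) = ((\<Sum>b<a. \<eta> (\<tau> q b)) + V (\<tau> q a) w) / \<beta>"

definition lang :: "'a list set" where
  "lang = {w. foldl \<tau> d w \<noteq> 0}"

section \<open>The language of the tree and padding with the minimal letter\<close>

lemma a0_le [simp]: "a0 \<le> a" by (simp add: Min_le)

lemma run_0 [simp]: "foldl \<tau> 0 w = 0"
  by (induction w) (auto simp: step_0)

lemma run_Q: "q \<in> insert 0 Q \<Longrightarrow> foldl \<tau> q w \<in> insert 0 Q"
  by (induction w arbitrary: q) (use step_Q step_0 in auto)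

lemma run_a0: "q \<in> Q \<Longrightarrow> foldl \<tau> q (replicate n a0) \<in> Q"
proof (induction n arbitrary: q)
  case (Suc n)
  have "\<tau> q a0 \<in> Q" using step_Q[OF Suc.prems, of a0] step_Min[OF Suc.prems] by auto
  then show ?case using Suc.IH by simp
qed simp

lemma mem_lang_iff: "w \<in> lang \<longleftrightarrow> foldl \<tau> d w \<in> Q"
  using run_Q[of d w] d_Q zero_Q unfolding lang_def by (metis insertCI insertE mem_Collect_eq)

text \<open>Rejection is permanent because 0 is absorbing.\<close>

lemma lang_appendD: "u @ v \<in> lang \<Longrightarrow> u \<in> lang"
  by (cases "foldl \<tau> d u = 0") (auto simp: lang_def)

lemma lang_append_a0: "w @ replicate n a0 \<in> lang \<longleftrightarrow> w \<in> lang"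
proof
  assume "w \<in> lang"
  then have "foldl \<tau> d w \<in> Q" by (simp add: mem_lang_iff)
  then show "w @ replicate n a0 \<in> lang" by (simp add: mem_lang_iff run_a0)
qed (rule lang_appendD)

lemma Nil_lang [simp]: "[] \<in> lang" using d_Q by (simp add: mem_lang_iff)

section \<open>Uniform errors of the word counts\<close>

lemma summable_err: "summable err"
  unfolding err_def[abs_def] by (intro summable_sum asymptotics) auto

lemma err_nonneg: "err m \<ge> 0" unfolding err_def by (intro sum_nonneg) auto

lemma num_0 [simp]: "T \<subseteq> Q \<Longrightarrow> num 0 T m = 0"
  using zero_Q by (auto simp: path_count_def)

lemma num_err:
  assumes "q \<in> insert 0 Q" "T \<subseteq> Q"
  shows "\<bar>real (num q T m) - \<kappa> T * \<eta> q * \<beta> ^ m\<bar> \<le> err m"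
proof (cases "q \<in> Q")
  case True
  have "\<bar>real (num q T m) - \<kappa> T * \<eta> q * \<beta> ^ m\<bar>
      \<le> (\<Sum>T\<in>Pow Q. \<bar>real (num q T m) - \<kappa> T * \<eta> q * \<beta> ^ m\<bar>)"
    by (rule member_le_sum) (use assms finite_Q in auto)
  also have "\<dots> \<le> err m" unfolding err_def
    by (rule member_le_sum[of q Q]) (use True finite_Q in \<open>auto intro: sum_nonneg\<close>)
  finally show ?thesis .
next
  case False
  with assms show ?thesis by (auto simp: \<eta>_0 err_nonneg)
qed

lemma suminf_err_nonneg: "suminf err \<ge> 0" by (intro suminf_nonneg summable_err err_nonneg)

lemma sum_err_le: "finite A \<Longrightarrow> (\<Sum>m\<in>A. err m) \<le> suminf err"
  by (rule sum_le_suminf[OF summable_err]) (auto simp: err_nonneg)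

lemma card_alphabet: "real CARD('a) \<ge> 1" 
  by (metis One_nat_def Suc_leI finite_UNIV_card_ge_0 of_nat_1 of_nat_mono finite)

lemma sum_err_le_count_error: "finite A \<Longrightarrow> (\<Sum>m\<in>A. err m) \<le> count_error"
  unfolding count_error_def using sum_err_le[of A] card_alphabet suminf_err_nonneg
  by (meson mult_le_cancel_right1 not_less order_trans)

lemma err_le_count_error: "err m \<le> count_error" using sum_err_le_count_error[of "{m}"] by simp

lemma count_error_nonneg: "count_error \<ge> 0" using err_le_count_error err_nonneg order_trans by blast

lemma num_limit:
  assumes "q \<in> insert 0 Q" "T \<subseteq> Q"
  shows "(\<lambda>m. real (num q T m) / \<beta> ^ m) \<longlonglongrightarrow> \<kappa> T * \<eta> q"
proof -
  have "(\<lambda>m. count_error * (1 / \<beta>) ^ m) \<longlonglongrightarrow> 0"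
    by (intro tendsto_mult_right_zero LIMSEQ_power_zero) (use \<beta>_gt_1 in auto)
  then have "(\<lambda>m. real (num q T m) / \<beta> ^ m - \<kappa> T * \<eta> q) \<longlonglongrightarrow> 0"
  proof (rule Lim_null_comparison[rotated])
    have "\<bar>real (num q T m) / \<beta> ^ m - \<kappa> T * \<eta> q\<bar> \<le> count_error * (1 / \<beta>) ^ m" for m
    proof -
      have "real (num q T m) / \<beta> ^ m - \<kappa> T * \<eta> q = (real (num q T m) - \<kappa> T * \<eta> q * \<beta> ^ m) / \<beta> ^ m"
        using \<beta>_gt_1 by (simp add: diff_divide_distrib)
      then have "\<bar>real (num q T m) / \<beta> ^ m - \<kappa> T * \<eta> q\<bar> = \<bar>real (num q T m) - \<kappa> T * \<eta> q * \<beta> ^ m\<bar> / \<beta> ^ m"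
        using \<beta>_gt_1 by (simp add: abs_divide)
      also have "\<dots> \<le> count_error / \<beta> ^ m"
        using num_err[OF assms, of m] err_le_count_error[of m] \<beta>_gt_1 by (intro divide_right_mono) auto
      finally show ?thesis by (simp add: power_one_over)
    qed
    then show "\<forall>\<^sub>F m in sequentially. norm (real (num q T m) / \<beta> ^ m - \<kappa> T * \<eta> q) \<le> count_error * (1 / \<beta>) ^ m" by simp
  qed
  then show ?thesis by (simp add: LIM_zero_iff)
qed

lemma \<kappa>_nonneg: "T \<subseteq> Q \<Longrightarrow> \<kappa> T \<ge> 0"
  using num_limit[of d T] d_Q \<eta>_d \<beta>_gt_1
  by (intro tendsto_lowerbound[of _ "\<kappa> T" sequentially]) (auto intro!: always_eventually)

lemma num_pos: "num d Q m \<ge> 1"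
proof -
  have "replicate m a0 \<in> {u. length u = m \<and> foldl \<tau> d u \<in> Q}" using d_Q by (simp add: run_a0)
  then have "{u. length u = m \<and> foldl \<tau> d u \<in> Q} \<noteq> {}" by blast
  moreover have "finite {u. length u = m \<and> foldl \<tau> d u \<in> Q}"
    by (rule finite_subset[OF _ finite_words_length[of m]]) auto
  ultimately show ?thesis by (simp add: path_count_def Suc_le_eq card_gt_0_iff)
qed

text \<open>If the coefficient vanished, the error would be at least the count itself, which is at
  least 1 because of the words consisting of \<open>a0\<close> only; but \<open>err\<close> tends to
  0.\<close>

lemma \<kappa>_pos: "\<kappa> Q > 0"
proof (rule ccontr)
  assume "\<not> \<kappa> Q > 0"
  then have "\<kappa> Q = 0" using \<kappa>_nonneg[of Q] by simp
  then have "err m \<ge> 1" for m using num_err[of d Q m] d_Q num_pos[of m] by simp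
  moreover have "err \<longlonglongrightarrow> 0" by (rule summable_LIMSEQ_zero[OF summable_err])
  ultimately show False using LIMSEQ_le_const[of err 0 1] by auto
qed

text \<open>A smaller word either starts with a smaller letter and continues freely, or shares the
  first letter and is smaller afterwards.\<close>

lemma below_Cons:
  "below q T (a # w) = (\<Sum>b<a. num (\<tau> q b) T (length w)) + below (\<tau> q a) T w"
proof -
  have "{u. (u, a # w) \<in> lex letter_order \<and> foldl \<tau> q u \<in> T} =
      (\<Union>b\<in>{..<a}. (#) b ` {u. length u = length w \<and> foldl \<tau> (\<tau> q b) u \<in> T}) \<union>
      (#) a ` {u. (u, w) \<in> lex letter_order \<and> foldl \<tau> (\<tau> q a) u \<in> T}" (is "?A = ?B \<union> ?C")
  proof (rule Set.set_eqI)
    fix u show "u \<in> ?A \<longleftrightarrow> u \<in> ?B \<union> ?C" by (cases u) (auto simp: image_iff)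
  qed
  moreover have "card (?B \<union> ?C) = card ?B + card ?C"
    by (rule card_Un_disjoint) (auto intro!: finite_imageI finite_subset[OF _ finite_words_length[of "length w"]]
      finite_subset[OF _ finite_words_lex[of w letter_order]])
  moreover have "card ?B = (\<Sum>b<a. card ((#) b ` {u. length u = length w \<and> foldl \<tau> (\<tau> q b) u \<in> T}))"
    by (rule card_UN_disjoint) (auto intro!: finite_imageI finite_subset[OF _ finite_words_length[of "length w"]])
  moreover have "\<dots> = (\<Sum>b<a. num (\<tau> q b) T (length w))"
    unfolding path_count_def by (intro sum.cong refl card_image) auto
  moreover have "card ?C = below (\<tau> q a) T w"
    unfolding below_def by (intro card_image) auto
  ultimately show ?thesis unfolding below_def by simp
qed

lemma below_Nil [simp]: "below q T [] = 0" by (simp add: below_def)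

text \<open>Dividing \<open>path_count_Suc\<close> by \<open>\<beta> ^ m\<close> and passing to the
  limit gives the eigenvector equation times \<open>\<kappa> Q\<close>, which is positive and
  cancels.\<close>

lemma eigen: 
  assumes q: "q \<in> insert 0 Q"
  shows "(\<Sum>a\<in>UNIV. \<eta> (\<tau> q a)) = \<beta> * \<eta> q"
proof -
  have t: "\<tau> q a \<in> insert 0 Q" for a using q step_Q step_0 by auto
  have "(\<lambda>m. \<Sum>a\<in>UNIV. real (num (\<tau> q a) Q m) / \<beta> ^ m) \<longlonglongrightarrow> (\<Sum>a\<in>UNIV. \<kappa> Q * \<eta> (\<tau> q a))"
    by (intro tendsto_sum num_limit t) auto
  moreover have "(\<Sum>a\<in>UNIV. real (num (\<tau> q a) Q m) / \<beta> ^ m) = \<beta> * (real (num q Q (Suc m)) / \<beta> ^ Suc m)" for m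
    using \<beta>_gt_1 by (simp add: path_count_Suc flip: sum_divide_distrib)
  moreover have "(\<lambda>m. \<beta> * (real (num q Q (Suc m)) / \<beta> ^ Suc m)) \<longlonglongrightarrow> \<beta> * (\<kappa> Q * \<eta> q)"
    by (intro tendsto_mult tendsto_const LIMSEQ_Suc num_limit q) auto
  ultimately have "(\<Sum>a\<in>UNIV. \<kappa> Q * \<eta> (\<tau> q a)) = \<beta> * (\<kappa> Q * \<eta> q)"
    using LIMSEQ_unique by simp
  then have "\<kappa> Q * (\<Sum>a\<in>UNIV. \<eta> (\<tau> q a)) = \<kappa> Q * (\<beta> * \<eta> q)"
    by (simp add: sum_distrib_left mult_ac)
  then show ?thesis using \<kappa>_pos by simp
qed

lemma \<eta>_nonneg: "q \<in> insert 0 Q \<Longrightarrow> \<eta> q \<ge> 0"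
  using \<eta>_pos[of q] \<eta>_0 by (auto intro: less_imp_le)

lemma step_Q0: "q \<in> insert 0 Q \<Longrightarrow> \<tau> q a \<in> insert 0 Q"
  using step_Q step_0 by auto

text \<open>\<open>below\<close> and \<open>V\<close> satisfy the same recursion along
  \<open>w\<close>, so errors come only from the subtrees that branch off to smaller
  letters.\<close>

lemma below_err:
  assumes "q \<in> insert 0 Q" "T \<subseteq> Q"
  shows "\<bar>real (below q T w) - \<kappa> T * \<beta> ^ length w * V q w\<bar> \<le> count_error"
proof -
  \<comment> \<open>The branches at one position share the same remaining length \<open>m\<close>,
    and different positions have different \<open>m\<close>, so each \<open>err m\<close> is charged
    at most \<open>CARD('a)\<close> times.\<close>
  have "\<bar>real (below q T w) - \<kappa> T * \<beta> ^ length w * V q w\<bar> \<le> real CARD('a) * (\<Sum>m<length w. err m)"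
    using assms(1)
  proof (induction w arbitrary: q)
    case (Cons a w)
    let ?n = "length w"
    have "\<kappa> T * \<beta> ^ length (a # w) * V q (a # w) = \<kappa> T * \<beta> ^ ?n * (\<beta> * V q (a # w))"
      by simp
    also have "\<beta> * V q (a # w) = (\<Sum>b<a. \<eta> (\<tau> q b)) + V (\<tau> q a) w"
      using \<beta>_gt_1 by simp
    finally have "real (below q T (a # w)) - \<kappa> T * \<beta> ^ length (a # w) * V q (a # w) =
        (\<Sum>b<a. real (num (\<tau> q b) T ?n) - \<kappa> T * \<eta> (\<tau> q b) * \<beta> ^ ?n) +
        (real (below (\<tau> q a) T w) - \<kappa> T * \<beta> ^ ?n * V (\<tau> q a) w)"
      by (simp add: below_Cons sum_subtractf sum_distrib_left sum_distrib_right algebra_simps)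
    also have "\<bar>\<dots>\<bar> \<le> (\<Sum>b<a. err ?n) + real CARD('a) * (\<Sum>m<?n. err m)"
    proof (rule order_trans[OF abs_triangle_ineq add_mono])
      show "\<bar>\<Sum>b<a. real (num (\<tau> q b) T ?n) - \<kappa> T * \<eta> (\<tau> q b) * \<beta> ^ ?n\<bar> \<le> (\<Sum>b<a. err ?n)"
        by (rule order_trans[OF sum_abs sum_mono]) (intro num_err step_Q0 Cons.prems assms)
      show "\<bar>real (below (\<tau> q a) T w) - \<kappa> T * \<beta> ^ ?n * V (\<tau> q a) w\<bar> \<le> real CARD('a) * (\<Sum>m<?n. err m)"
        by (intro Cons.IH step_Q0 Cons.prems)
    qed
    also have "(\<Sum>b<a. err ?n) \<le> real CARD('a) * err ?n"
      by (simp add: err_nonneg mult_right_mono card_mono)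
    finally show ?case by (simp add: algebra_simps)
  qed simp
  also have "\<dots> \<le> count_error" unfolding count_error_def by (intro mult_left_mono sum_err_le) auto
  finally show ?thesis .
qed

section \<open>Left endpoints and the lexicographical order\<close>

lemma V_nonneg: "q \<in> insert 0 Q \<Longrightarrow> V q w \<ge> 0"
proof (induction w arbitrary: q)
  case (Cons a w)
  then show ?case using \<beta>_gt_1
    by (auto intro!: divide_nonneg_pos add_nonneg_nonneg sum_nonneg \<eta>_nonneg step_Q0 simp del: insert_iff)
qed simp

lemma V_append: "V q (u @ v) = V q u + V (foldl \<tau> q u) v / \<beta> ^ length u"
  using \<beta>_gt_1 by (induction u arbitrary: q) (auto simp: field_simps)

text \<open>No letter lies below \<open>a0\<close>, so the \<open>a0\<close>-child starts at the
  left end of its parent.\<close>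

lemma V_a0: "V q (replicate n a0) = 0"
proof (induction n arbitrary: q)
  case (Suc n)
  have "{..<a0} = {}" by (auto simp: not_less)
  then show ?case using Suc by simp
qed simp

lemma V_append_a0 [simp]: "V q (w @ replicate n a0) = V q w"
  by (simp add: V_append V_a0)

text \<open>The interval of \<open>a # w\<close> lies inside that of the child \<open>a\<close>,
  which ends where the children up to \<open>a\<close> end. The bound for \<open>w\<close> is a
  premise so that the induction for \<open>V_upper\<close> can supply it.\<close>

lemma V_upper_Cons:
  assumes "q \<in> insert 0 Q" and IH: "V (\<tau> q a) w + \<eta> (foldl \<tau> (\<tau> q a) w) / \<beta> ^ length w \<le> \<eta> (\<tau> q a)"
  shows "V q (a # w) + \<eta> (foldl \<tau> q (a # w)) / \<beta> ^ length (a # w) \<le> (\<Sum>b\<le>a. \<eta> (\<tau> q b)) / \<beta>"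
proof -
  have "{..a} = insert a {..<a}" by auto
  then have "V q (a # w) + \<eta> (foldl \<tau> q (a # w)) / \<beta> ^ length (a # w) =
    ((\<Sum>b<a. \<eta> (\<tau> q b)) + (V (\<tau> q a) w + \<eta> (foldl \<tau> (\<tau> q a) w) / \<beta> ^ length w)) / \<beta>"
    and "(\<Sum>b\<le>a. \<eta> (\<tau> q b)) / \<beta> = ((\<Sum>b<a. \<eta> (\<tau> q b)) + \<eta> (\<tau> q a)) / \<beta>"
    using \<beta>_gt_1 by (auto simp: field_simps)
  then show ?thesis using IH \<beta>_gt_1 by (simp add: divide_right_mono)
qed

text \<open>By \<open>eigen\<close> the children of a node fill its interval exactly, so no
  descendant reaches beyond the right end.\<close>

lemma V_upper: "q \<in> insert 0 Q \<Longrightarrow> V q w + \<eta> (foldl \<tau> q w) / \<beta> ^ length w \<le> \<eta> q"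
proof (induction w arbitrary: q)
  case (Cons a w)
  have "V q (a # w) + \<eta> (foldl \<tau> q (a # w)) / \<beta> ^ length (a # w) \<le> (\<Sum>b\<le>a. \<eta> (\<tau> q b)) / \<beta>"
    by (intro V_upper_Cons Cons step_Q0)
  also have "\<dots> \<le> (\<Sum>b\<in>UNIV. \<eta> (\<tau> q b)) / \<beta>"
    using \<beta>_gt_1 by (intro divide_right_mono sum_mono2 \<eta>_nonneg step_Q0 Cons.prems) auto
  also have "\<dots> = \<eta> q" using eigen[OF Cons.prems] \<beta>_gt_1 by simp
  finally show ?case .
qed simp

text \<open>At the first differing letter the words enter different children, whose intervals follow
  one another in the order of the letters.\<close>

lemma V_lex: 
  assumes "(u, v) \<in> lex letter_order" "q \<in> insert 0 Q"
  shows "V q u + \<eta> (foldl \<tau> q u) / \<beta> ^ length u \<le> V q v"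
  using assms
proof (induction u arbitrary: v q)
  case (Cons a u)
  then obtain b w where v: "v = b # w" by (cases v) auto
  show ?case
  proof (cases "a < b")
    case True
    have "V q (a # u) + \<eta> (foldl \<tau> q (a # u)) / \<beta> ^ length (a # u) \<le> (\<Sum>c\<le>a. \<eta> (\<tau> q c)) / \<beta>"
      by (intro V_upper_Cons V_upper Cons step_Q0)
    also have "\<dots> \<le> (\<Sum>c<b. \<eta> (\<tau> q c)) / \<beta>"
      using \<beta>_gt_1 True by (intro divide_right_mono sum_mono2 \<eta>_nonneg step_Q0 Cons.prems) auto
    also have "\<dots> \<le> V q v"
      using \<beta>_gt_1 V_nonneg[OF step_Q0[OF Cons.prems(2)]] by (simp add: v divide_right_mono)
    finally show ?thesis .
  next
    case False
    then have "b = a" "(u, w) \<in> lex letter_order" using Cons.prems v by auto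
    have "V q (a # u) + \<eta> (foldl \<tau> q (a # u)) / \<beta> ^ length (a # u) =
        ((\<Sum>c<a. \<eta> (\<tau> q c)) + (V (\<tau> q a) u + \<eta> (foldl \<tau> (\<tau> q a) u) / \<beta> ^ length u)) / \<beta>"
      using \<beta>_gt_1 by (simp add: add_divide_distrib)
    also have "\<dots> \<le> ((\<Sum>c<a. \<eta> (\<tau> q c)) + V (\<tau> q a) w) / \<beta>"
      using Cons.IH[OF \<open>(u, w) \<in> lex letter_order\<close> step_Q0[OF Cons.prems(2), of a]] \<beta>_gt_1
      by (simp add: divide_right_mono)
    also have "\<dots> = V q v" by (simp add: v \<open>b = a\<close>)
    finally show ?thesis .
  qed
qed simp

text \<open>A word in \<open>lang\<close> has an interval of positive length, which makes the
  estimate of \<open>V_lex\<close> strict. Equal lengths matter, since padding with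
  \<open>a0\<close> leaves \<open>V\<close> unchanged.\<close>

lemma V_less_iff_lex:
  assumes "u \<in> lang" "v \<in> lang" "length u = length v"
  shows "V d u < V d v \<longleftrightarrow> (u, v) \<in> lex letter_order"
proof -
  have *: "V d x < V d y" if "x \<in> lang" "(x, y) \<in> lex letter_order" for x y
    using V_lex[OF that(2), of d] d_Q \<eta>_pos[of "foldl \<tau> d x"] that(1) \<beta>_gt_1
    by (auto simp: mem_lang_iff) (smt (verit) divide_pos_pos zero_less_power)
  from lex_letter_order_total[OF assms(3)] *[of u v] *[of v u] assms show ?thesis
    by (metis order_less_asym order_less_irrefl)
qed

lemma V_inj: "u \<in> lang \<Longrightarrow> v \<in> lang \<Longrightarrow> length u = length v \<Longrightarrow> V d u = V d v \<Longrightarrow> u = v"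
  using lex_letter_order_total[of u v] V_less_iff_lex[of u v] V_less_iff_lex[of v u] by auto

definition \<eta>_bound :: real where "\<eta>_bound = (\<Sum>q\<in>Q. \<eta> q)"

lemma \<eta>_le_bound: "q \<in> insert 0 Q \<Longrightarrow> \<eta> q \<le> \<eta>_bound"
  unfolding \<eta>_bound_def using finite_Q \<eta>_nonneg
  by (cases "q \<in> Q") (auto intro!: member_le_sum sum_nonneg simp: \<eta>_0)

text \<open>Descendants of \<open>u\<close> stay in its interval; \<open>\<eta>_bound\<close>
  replaces the factor depending on the state reached by \<open>u\<close>.\<close>

lemma V_append_bounds:
  "V d u \<le> V d (u @ v)" "V d (u @ v) \<le> V d u + \<eta>_bound / \<beta> ^ length u"
proof -
  have q: "foldl \<tau> d u \<in> insert 0 Q" using run_Q d_Q by simp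
  have "\<eta> (foldl \<tau> (foldl \<tau> d u) v) / \<beta> ^ length v \<ge> 0"
    using \<beta>_gt_1 by (intro divide_nonneg_pos \<eta>_nonneg run_Q q) auto
  then have "V (foldl \<tau> d u) v \<le> \<eta>_bound"
    using V_upper[OF q, of v] \<eta>_le_bound[OF q] by linarith
  then show "V d (u @ v) \<le> V d u + \<eta>_bound / \<beta> ^ length u"
    using \<beta>_gt_1 by (simp add: V_append divide_right_mono)
  show "V d u \<le> V d (u @ v)" using V_nonneg[OF q] \<beta>_gt_1 by (simp add: V_append)
qed

subsection \<open>Normalized values\<close>

text \<open>One direction is closure under prefixes; for the other, the finite prefixes of
  \<open>u\<close> form an approximating sequence.\<close>

lemma omega_language_iff: "u \<in> omega_language lang \<longleftrightarrow> (\<forall>n. map u [0..<n] \<in> lang)"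
proof
  assume "u \<in> omega_language lang"
  then obtain w where w: "\<And>k. w k \<in> lang" "word_limit w u" by (auto simp: omega_language_def)
  show "\<forall>n. map u [0..<n] \<in> lang"
  proof
    fix n
    have "omega_prefix (map u [0..<n]) u" by (simp add: omega_prefix_def)
    then have "finite {k. \<not> prefix (map u [0..<n]) (w k)}" using w(2) by (simp add: word_limit_def)
    then obtain k where "prefix (map u [0..<n]) (w k)"
      by (metis (mono_tags, lifting) infinite_UNIV_nat mem_Collect_eq UNIV_eq_I)
    then show "map u [0..<n] \<in> lang" using w(1)[of k] lang_appendD by (auto simp: prefix_def)
  qed
next
  assume *: "\<forall>n. map u [0..<n] \<in> lang"
  have "word_limit (\<lambda>k. map u [0..<k]) u"
    unfolding word_limit_def
  proof (intro allI impI)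
    fix p assume p: "omega_prefix p u"
    have "prefix p (map u [0..<k])" if "length p \<le> k" for k
    proof -
      have "[0..<k] = [0..<length p] @ [length p..<k]" using that
        by (metis le_add_diff_inverse upt_add_eq_append zero_le)
      then show ?thesis using p unfolding omega_prefix_def by (metis map_append prefixI)
    qed
    then have "{k. \<not> prefix p (map u [0..<k])} \<subseteq> {..<length p}" by (auto simp: not_le[symmetric])
    then show "finite {k. \<not> prefix p (map u [0..<k])}" by (rule finite_subset) simp
  qed
  then show "u \<in> omega_language lang" using * by (auto simp: omega_language_def)
qed

section \<open>Counting the language and its exponential growth\<close>

lemma card_lang_lengths:
  assumes "finite A"
  shows "card {v \<in> lang. length v \<in> A} = (\<Sum>j\<in>A. num d Q j)"
proof -
  have "{v \<in> lang. length v \<in> A} = (\<Union>j\<in>A. {u. length u = j \<and> foldl \<tau> d u \<in> Q})"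
    by (auto simp: mem_lang_iff)
  also have "card \<dots> = (\<Sum>j\<in>A. num d Q j)" unfolding path_count_def
    by (rule card_UN_disjoint) (use assms in \<open>auto intro: finite_subset[OF _ finite_words_length]\<close>)
  finally show ?thesis .
qed

lemma num_upto_lang: "num_upto lang k = (\<Sum>j\<le>k. num d Q j)"
  unfolding num_upto_def using card_lang_lengths[of "{..k}"] by simp

lemma val_lang: "val lang w = (\<Sum>j<length w. num d Q j) + below d Q w"
proof -
  have eq: "{v \<in> lang. (v, w) \<in> shortlex} = {v \<in> lang. length v \<in> {..<length w}} \<union>
      {u. (u, w) \<in> lex letter_order \<and> foldl \<tau> d u \<in> Q}"
    by (auto simp: lenlex_conv mem_lang_iff lex_length_eq)
  have fin: "finite {v \<in> lang. length v \<in> {..<length w}}"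
    by (rule finite_subset[OF _ finite_lists_length_le[of UNIV "length w"]]) auto
  show ?thesis unfolding val_def eq below_def
    by (subst card_Un_disjoint)
      (auto simp: fin card_lang_lengths dest: lex_length_eq
        intro: finite_subset[OF _ finite_words_lex[of w letter_order]] simp del: lessThan_iff)
qed

text \<open>The main terms form a geometric sum, and the errors have a bounded total, which vanishes
  after division by \<open>\<beta> ^ n\<close>.\<close>

lemma sum_num_limit: "(\<lambda>n. real (\<Sum>j<n. num d Q j) / \<beta> ^ n) \<longlonglongrightarrow> \<kappa> Q / (\<beta> - 1)"
proof -
  have bound: "norm (real (\<Sum>j<n. num d Q j) / \<beta> ^ n - \<kappa> Q / (\<beta> - 1)) \<le> (count_error + \<kappa> Q / (\<beta> - 1)) * (1 / \<beta>) ^ n" for n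
  proof -
    have geo: "(\<Sum>j<n. \<beta> ^ j) = (\<beta> ^ n - 1) / (\<beta> - 1)"
      using \<beta>_gt_1 by (simp add: geometric_sum)
    have "real (\<Sum>j<n. num d Q j) - \<kappa> Q / (\<beta> - 1) * \<beta> ^ n
        = (\<Sum>j<n. real (num d Q j) - \<kappa> Q * \<eta> d * \<beta> ^ j) - \<kappa> Q / (\<beta> - 1)"
      by (simp add: \<eta>_d sum_subtractf geo diff_divide_distrib right_diff_distrib flip: sum_distrib_left)
    also have "\<bar>\<dots>\<bar> \<le> (\<Sum>j<n. err j) + \<kappa> Q / (\<beta> - 1)"
    proof (rule order_trans[OF abs_triangle_ineq4 add_mono])
      show "\<bar>\<Sum>j<n. real (num d Q j) - \<kappa> Q * \<eta> d * \<beta> ^ j\<bar> \<le> (\<Sum>j<n. err j)"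
        by (rule order_trans[OF sum_abs sum_mono]) (rule num_err, use d_Q in auto)
    qed (use \<kappa>_pos \<beta>_gt_1 in simp)
    also have "(\<Sum>j<n. err j) \<le> count_error" by (rule sum_err_le_count_error) simp
    finally have *: "\<bar>real (\<Sum>j<n. num d Q j) - \<kappa> Q / (\<beta> - 1) * \<beta> ^ n\<bar> \<le> count_error + \<kappa> Q / (\<beta> - 1)" by simp
    have "real (\<Sum>j<n. num d Q j) / \<beta> ^ n - \<kappa> Q / (\<beta> - 1) =
       (real (\<Sum>j<n. num d Q j) - \<kappa> Q / (\<beta> - 1) * \<beta> ^ n) / \<beta> ^ n"
      using \<beta>_gt_1 by (simp add: diff_divide_distrib)
    then have "norm (real (\<Sum>j<n. num d Q j) / \<beta> ^ n - \<kappa> Q / (\<beta> - 1)) =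
       \<bar>real (\<Sum>j<n. num d Q j) - \<kappa> Q / (\<beta> - 1) * \<beta> ^ n\<bar> / \<beta> ^ n"
      using \<beta>_gt_1 by (simp add: abs_divide)
    also have "\<dots> \<le> (count_error + \<kappa> Q / (\<beta> - 1)) / \<beta> ^ n"
      using * \<beta>_gt_1 by (intro divide_right_mono) auto
    finally show ?thesis by (simp add: power_one_over)
  qed
  have "(\<lambda>n. (count_error + \<kappa> Q / (\<beta> - 1)) * (1 / \<beta>) ^ n) \<longlonglongrightarrow> 0"
    by (intro tendsto_mult_right_zero LIMSEQ_power_zero) (use \<beta>_gt_1 in auto)
  then have "(\<lambda>n. real (\<Sum>j<n. num d Q j) / \<beta> ^ n - \<kappa> Q / (\<beta> - 1)) \<longlonglongrightarrow> 0"
    by (rule Lim_null_comparison[rotated]) (use bound in simp)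
  then show ?thesis by (simp only: LIM_zero_iff)
qed

lemma num_upto_limit: "(\<lambda>n. real (num_upto lang n) / \<beta> ^ n) \<longlonglongrightarrow> \<beta> * (\<kappa> Q / (\<beta> - 1))"
proof -
  have "(\<lambda>n. \<beta> * (real (\<Sum>j<Suc n. num d Q j) / \<beta> ^ Suc n)) \<longlonglongrightarrow> \<beta> * (\<kappa> Q / (\<beta> - 1))"
    by (intro tendsto_mult tendsto_const LIMSEQ_Suc[OF sum_num_limit])
  moreover have "\<beta> * (real (\<Sum>j<Suc n. num d Q j) / \<beta> ^ Suc n) = real (num_upto lang n) / \<beta> ^ n" for n
    using \<beta>_gt_1 by (simp add: num_upto_lang lessThan_Suc_atMost del: sum.lessThan_Suc)
  ultimately show ?thesis by simp
qed

lemma num_upto_pos: "num_upto lang n \<ge> 1"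
proof -
  have "num_upto lang n \<ge> num d Q 0" unfolding num_upto_lang
    by (rule member_le_sum) auto
  then show ?thesis using num_pos[of 0] by simp
qed

text \<open>\<open>num_upto lang n\<close> is \<open>\<beta> ^ n\<close> times a factor tending to
  \<open>c > 0\<close>, whose logarithm disappears after division by \<open>n\<close>.\<close>

lemma has_growth_base_\<beta>: "has_growth_base lang \<beta>"
proof -
  define c where "c = \<beta> * (\<kappa> Q / (\<beta> - 1))"
  have c: "c > 0" using \<beta>_gt_1 \<kappa>_pos by (simp add: c_def)
  have "(\<lambda>n. ln (real (num_upto lang n) / \<beta> ^ n)) \<longlonglongrightarrow> ln c"
    by (rule tendsto_ln[OF num_upto_limit[folded c_def]]) (use c in simp)
  then have "(\<lambda>n. ln (real (num_upto lang n) / \<beta> ^ n) * (1 / real n) + ln \<beta>) \<longlonglongrightarrow> ln c * 0 + ln \<beta>"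
    by (intro tendsto_add tendsto_mult tendsto_const lim_1_over_n)
  moreover have "\<forall>\<^sub>F n in sequentially. ln (real (num_upto lang n) / \<beta> ^ n) * (1 / real n) + ln \<beta>
      = 1 / real n * ln (real (num_upto lang n))"
    using eventually_gt_at_top[of 0]
  proof eventually_elim
    case (elim n)
    have "real (num_upto lang n) > 0" using num_upto_pos[of n] by simp
    then have "ln (real (num_upto lang n) / \<beta> ^ n) = ln (real (num_upto lang n)) - real n * ln \<beta>"
      using \<beta>_gt_1 by (simp add: ln_div ln_realpow)
    then show ?case using elim by (simp add: field_simps)
  qed
  ultimately have "(\<lambda>n. 1 / real n * ln (real (num_upto lang n))) \<longlonglongrightarrow> ln \<beta>"
    by (simp add: tendsto_cong)
  then show ?thesis using \<beta>_gt_1 by (simp add: has_growth_base_def)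
qed

lemma growth_base_lang: "growth_base lang = \<beta>"
  unfolding growth_base_def
proof (rule the_equality)
  show "has_growth_base lang \<beta>" by (rule has_growth_base_\<beta>)
next
  fix b assume "has_growth_base lang b"
  then have "ln b = ln \<beta>" "b > 1"
    using has_growth_base_\<beta> unfolding has_growth_base_def by (blast intro: LIMSEQ_unique)+
  then show "b = \<beta>" using \<beta>_gt_1 by simp
qed

section \<open>Values of infinite words\<close>

definition V\<omega> :: "(nat \<Rightarrow> 'a) \<Rightarrow> real" where
  "V\<omega> u = lim (\<lambda>n. V d (map u [0..<n]))"

lemma map_upt_split: "n \<le> m \<Longrightarrow> map u [0..<m] = map u [0..<n] @ map u [n..<m]"
  by (metis le_add_diff_inverse map_append upt_add_eq_append zero_le)

text \<open>The values of the prefixes are nondecreasing and bounded by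
  \<open>\<eta>_bound\<close>.\<close>

lemma V\<omega>_limit: "(\<lambda>n. V d (map u [0..<n])) \<longlonglongrightarrow> V\<omega> u"
proof -
  have inc: "incseq (\<lambda>n. V d (map u [0..<n]))"
    by (rule incseq_SucI) (simp add: V_append_bounds)
  have "\<forall>n. V d (map u [0..<n]) \<le> \<eta>_bound"
    using V_append_bounds(2)[of "[]"] by simp
  from incseq_convergent[OF inc this] have "convergent (\<lambda>n. V d (map u [0..<n]))"
    unfolding convergent_def by blast
  then show ?thesis unfolding V\<omega>_def by (simp add: convergent_LIMSEQ_iff)
qed

lemma V\<omega>_bounds: "V d (map u [0..<n]) \<le> V\<omega> u" "V\<omega> u \<le> V d (map u [0..<n]) + \<eta>_bound / \<beta> ^ n"
proof -
  have ev: "\<forall>\<^sub>F m in sequentially. V d (map u [0..<n]) \<le> V d (map u [0..<m]) \<and>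
      V d (map u [0..<m]) \<le> V d (map u [0..<n]) + \<eta>_bound / \<beta> ^ n"
    using eventually_ge_at_top[of n]
  proof eventually_elim
    case (elim m)
    then show ?case using V_append_bounds[of "map u [0..<n]" "map u [n..<m]"]
      by (simp add: map_upt_split[of n m])
  qed
  show "V d (map u [0..<n]) \<le> V\<omega> u"
    by (rule tendsto_lowerbound[OF V\<omega>_limit[of u]]) (use ev in \<open>auto elim: eventually_mono\<close>)
  show "V\<omega> u \<le> V d (map u [0..<n]) + \<eta>_bound / \<beta> ^ n"
    by (rule tendsto_upperbound[OF V\<omega>_limit[of u]]) (use ev in \<open>auto elim: eventually_mono\<close>)
qed

lemma word_limit_eventually:
  assumes "word_limit w u"
  shows "\<forall>\<^sub>F k in sequentially. prefix (map u [0..<n]) (w k)"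
proof -
  have "finite {k. \<not> prefix (map u [0..<n]) (w k)}"
    using assms by (auto simp: word_limit_def omega_prefix_def)
  then show ?thesis by (simp add: eventually_cofinite[symmetric] cofinite_eq_sequentially)
qed

lemma word_limit_length:
  assumes "word_limit w u"
  shows "filterlim (\<lambda>k. length (w k)) sequentially sequentially"
  unfolding filterlim_at_top
proof
  fix n
  show "\<forall>\<^sub>F k in sequentially. n \<le> length (w k)"
    using word_limit_eventually[OF assms, of n] by eventually_elim (auto dest: prefix_length_le)
qed

text \<open>Words that agree with \<open>u\<close> in the first \<open>n\<close> letters have values
  in one interval of length \<open>\<eta>_bound / \<beta> ^ n\<close>, which also contains
  \<open>V\<omega> u\<close>.\<close>

lemma word_limit_V:
  assumes "word_limit w u"
  shows "(\<lambda>k. V d (w k)) \<longlonglongrightarrow> V\<omega> u"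
proof (rule LIMSEQ_I)
  fix e :: real assume e: "e > 0"
  have "(\<lambda>n. \<eta>_bound * (1 / \<beta>) ^ n) \<longlonglongrightarrow> 0"
    by (intro tendsto_mult_right_zero LIMSEQ_power_zero) (use \<beta>_gt_1 in auto)
  then have "\<forall>\<^sub>F n in sequentially. \<eta>_bound * (1 / \<beta>) ^ n < e" using e by (rule order_tendstoD)
  then obtain n where "\<eta>_bound * (1 / \<beta>) ^ n < e" by (auto simp: eventually_sequentially)
  then have n: "\<eta>_bound / \<beta> ^ n < e" by (simp add: power_one_over)
  have "\<forall>\<^sub>F k in sequentially. norm (V d (w k) - V\<omega> u) < e"
    using word_limit_eventually[OF assms, of n]
  proof eventually_elim
    case (elim k)
    then obtain v where "w k = map u [0..<n] @ v" by (auto simp: prefix_def)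
    then show ?case
      using V_append_bounds[of "map u [0..<n]" v] V\<omega>_bounds[where u = u and n = n] n by simp
  qed
  then show "\<exists>no. \<forall>k\<ge>no. norm (V d (w k) - V\<omega> u) < e" by (simp add: eventually_sequentially)
qed

text \<open>After division by \<open>\<beta> ^ length (w k)\<close>, the shorter words contribute
  \<open>\<kappa> Q / (\<beta> - 1)\<close>, those of equal length
  \<open>\<kappa> Q * V\<omega> u\<close>, and \<open>num_upto\<close> tends to
  \<open>\<beta>\<close> times the former. The affine map in \<open>norm_val_omega\<close> turns the
  resulting quotient back into \<open>V\<omega> u\<close>.\<close>

lemma has_val_omega_lang:
  assumes "u \<in> omega_language lang"
  shows "has_val_omega lang u ((1 + (\<beta> - 1) * V\<omega> u) / \<beta>)"
  unfolding has_val_omega_def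
proof (intro conjI allI impI assms)
  fix w assume w: "(\<forall>k. w k \<in> lang) \<and> word_limit w u"
  let ?l = "\<lambda>k. length (w k)"
  note len = word_limit_length[OF conjunct2[OF w]]
  have 1: "(\<lambda>k. real (\<Sum>j<?l k. num d Q j) / \<beta> ^ ?l k) \<longlonglongrightarrow> \<kappa> Q / (\<beta> - 1)"
    by (rule filterlim_compose[OF sum_num_limit len])
  have 2: "(\<lambda>k. real (num_upto lang (?l k)) / \<beta> ^ ?l k) \<longlonglongrightarrow> \<beta> * (\<kappa> Q / (\<beta> - 1))"
    by (rule filterlim_compose[OF num_upto_limit len])
  have 3: "(\<lambda>k. real (below d Q (w k)) / \<beta> ^ ?l k) \<longlonglongrightarrow> \<kappa> Q * V\<omega> u"
  proof -
    have "(\<lambda>n. count_error * (1 / \<beta>) ^ n) \<longlonglongrightarrow> 0"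
      by (intro tendsto_mult_right_zero LIMSEQ_power_zero) (use \<beta>_gt_1 in auto)
    then have *: "(\<lambda>k. count_error * (1 / \<beta>) ^ ?l k) \<longlonglongrightarrow> 0" by (rule filterlim_compose[OF _ len])
    have "(\<lambda>k. real (below d Q (w k)) / \<beta> ^ ?l k - \<kappa> Q * V d (w k)) \<longlonglongrightarrow> 0"
    proof (rule Lim_null_comparison[OF _ *], rule always_eventually, rule allI)
      fix k
      have "real (below d Q (w k)) / \<beta> ^ ?l k - \<kappa> Q * V d (w k) =
          (real (below d Q (w k)) - \<kappa> Q * \<beta> ^ ?l k * V d (w k)) / \<beta> ^ ?l k"
        using \<beta>_gt_1 by (simp add: diff_divide_distrib)
      then have "norm (real (below d Q (w k)) / \<beta> ^ ?l k - \<kappa> Q * V d (w k)) =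
          \<bar>real (below d Q (w k)) - \<kappa> Q * \<beta> ^ ?l k * V d (w k)\<bar> / \<beta> ^ ?l k"
        using \<beta>_gt_1 by (simp add: abs_divide)
      also have "\<dots> \<le> count_error / \<beta> ^ ?l k"
        using below_err[of d Q "w k"] d_Q \<beta>_gt_1 by (intro divide_right_mono) auto
      finally show "norm (real (below d Q (w k)) / \<beta> ^ ?l k - \<kappa> Q * V d (w k)) \<le> count_error * (1 / \<beta>) ^ ?l k"
        by (simp add: power_one_over)
    qed
    from tendsto_add[OF this tendsto_mult[OF tendsto_const word_limit_V[OF conjunct2[OF w]], of "\<kappa> Q"]]
    show ?thesis by simp
  qed
  have c: "\<beta> * (\<kappa> Q / (\<beta> - 1)) \<noteq> 0" using \<beta>_gt_1 \<kappa>_pos by simp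
  have lim: "(\<lambda>k. (real (\<Sum>j<?l k. num d Q j) / \<beta> ^ ?l k + real (below d Q (w k)) / \<beta> ^ ?l k) /
      (real (num_upto lang (?l k)) / \<beta> ^ ?l k))
      \<longlonglongrightarrow> (\<kappa> Q / (\<beta> - 1) + \<kappa> Q * V\<omega> u) / (\<beta> * (\<kappa> Q / (\<beta> - 1)))"
    by (intro tendsto_intros 1 2 3 c)
  have eq1: "(\<kappa> Q / (\<beta> - 1) + \<kappa> Q * V\<omega> u) / (\<beta> * (\<kappa> Q / (\<beta> - 1))) = (1 + (\<beta> - 1) * V\<omega> u) / \<beta>"
    using \<beta>_gt_1 \<kappa>_pos by (simp add: divide_simps) (simp add: algebra_simps)
  have eq2: "(real (\<Sum>j<?l k. num d Q j) / \<beta> ^ ?l k + real (below d Q (w k)) / \<beta> ^ ?l k) /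
      (real (num_upto lang (?l k)) / \<beta> ^ ?l k) = real (val lang (w k)) / real (num_upto lang (?l k))" for k
  proof -
    have "real (\<Sum>j<?l k. num d Q j) / \<beta> ^ ?l k + real (below d Q (w k)) / \<beta> ^ ?l k =
      real (val lang (w k)) / \<beta> ^ ?l k" by (simp add: val_lang add_divide_distrib)
    then show ?thesis using \<beta>_gt_1 by simp
  qed
  show "(\<lambda>k. real (val lang (w k)) / real (num_upto lang (length (w k))))
      \<longlonglongrightarrow> (1 + (\<beta> - 1) * V\<omega> u) / \<beta>" using lim unfolding eq1 eq2 .
qed

lemma norm_val_omega_lang:
  assumes "u \<in> omega_language lang"
  shows "norm_val_omega lang u = V\<omega> u"
proof -
  \<comment> \<open>Uniqueness of the value rests on an actual approximating sequence, as
    \<open>has_val_omega\<close> quantifies universally over such sequences.\<close>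
  obtain w where w: "\<forall>k. w k \<in> lang" "word_limit w u"
    using assms by (auto simp: omega_language_def)
  have "val_omega lang u = (1 + (\<beta> - 1) * V\<omega> u) / \<beta>"
    unfolding val_omega_def
  proof (rule the_equality)
    show "has_val_omega lang u ((1 + (\<beta> - 1) * V\<omega> u) / \<beta>)"
      by (rule has_val_omega_lang[OF assms])
  next
    fix x assume "has_val_omega lang u x"
    then show "x = (1 + (\<beta> - 1) * V\<omega> u) / \<beta>"
      using w has_val_omega_lang[OF assms] LIMSEQ_unique unfolding has_val_omega_def by blast
  qed
  then show ?thesis using \<beta>_gt_1 by (simp add: norm_val_omega_def growth_base_lang)
qed

section \<open>Least infinite extensions\<close>

definition pad :: "'a list \<Rightarrow> nat \<Rightarrow> 'a" where
  "pad w i = (if i < length w then w ! i else a0)"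

lemma map_pad: "map (pad w) [0..<n] = take n w @ replicate (n - length w) a0"
  by (rule nth_equalityI) (auto simp: pad_def nth_append)

lemma pad_omega_language: "w \<in> lang \<Longrightarrow> pad w \<in> omega_language lang"
  unfolding omega_language_iff map_pad lang_append_a0
  by (metis append_take_drop_id lang_appendD)

lemma omega_prefix_pad: "omega_prefix w (pad w)"
  by (simp add: omega_prefix_def map_pad)

lemma least_extension_lang:
  assumes "w \<in> lang"
  shows "least_extension lang w = pad w"
proof -
  have min: "pad w = v \<or> omega_less (pad w) v" if "omega_prefix w v" for v
  proof (cases "pad w = v")
    case False
    \<comment> \<open>At the first difference the word \<open>w\<close> is already exhausted, so
      \<open>pad w n\<close> is the minimal letter.\<close>
    define n where "n = (LEAST n. pad w n \<noteq> v n)"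
    have "\<exists>n. pad w n \<noteq> v n" using False by auto
    then have n: "pad w n \<noteq> v n" unfolding n_def by (rule LeastI_ex)
    have before: "\<forall>i<n. pad w i = v i" unfolding n_def using not_less_Least by blast
    have "v i = w ! i" if "i < length w" for i
      using \<open>omega_prefix w v\<close> that unfolding omega_prefix_def
      by (metis add.left_neutral nth_map_upt diff_zero)
    then have "length w \<le> n" using n by (metis not_less pad_def)
    then have "pad w n < v n" using n a0_le[of "v n"] by (simp add: pad_def order_less_le)
    then show ?thesis using before by (auto simp: omega_less_def)
  qed simp
  \<comment> \<open>Asymmetry makes the minimum unique, as \<open>THE\<close> demands.\<close>
  have asym: "\<not> omega_less v u" if uv: "omega_less u v" for u v :: "nat \<Rightarrow> 'a"
  proof
    assume "omega_less v u"
    then obtain m where m: "\<forall>i<m. v i = u i" "v m < u m" by (auto simp: omega_less_def)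
    obtain n where n: "\<forall>i<n. u i = v i" "u n < v n" using uv by (auto simp: omega_less_def)
    from m n show False by (metis linorder_neqE_nat order_less_asym order_less_irrefl)
  qed
  show ?thesis unfolding least_extension_def
  proof (rule the_equality)
    show "pad w \<in> omega_language lang \<and> omega_prefix w (pad w) \<and>
        (\<forall>v\<in>omega_language lang. omega_prefix w v \<longrightarrow> pad w = v \<or> omega_less (pad w) v)"
      using min pad_omega_language[OF assms] omega_prefix_pad by simp
  next
    fix u assume "u \<in> omega_language lang \<and> omega_prefix w u \<and>
        (\<forall>v\<in>omega_language lang. omega_prefix w v \<longrightarrow> u = v \<or> omega_less u v)"
    then show "u = pad w"
      using min[of u] asym[of u "pad w"] pad_omega_language[OF assms] omega_prefix_pad[of w] by blast
  qed
qed

text \<open>Once \<open>w\<close> is exhausted, longer prefixes of \<open>pad w\<close> only append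
  \<open>a0\<close>, so their values stay at \<open>V d w\<close>.\<close>

lemma norm_val_lang:
  assumes "w \<in> lang"
  shows "norm_val lang w = V d w"
proof -
  have "\<forall>\<^sub>F n in sequentially. V d (map (pad w) [0..<n]) = V d w"
    using eventually_ge_at_top[of "length w"] by eventually_elim (simp add: map_pad)
  then have "(\<lambda>n. V d (map (pad w) [0..<n])) \<longlonglongrightarrow> V d w" by (rule tendsto_eventually)
  then have "V\<omega> (pad w) = V d w" using V\<omega>_limit LIMSEQ_unique by blast
  then show ?thesis
    by (simp add: norm_val_def least_extension_lang[OF assms] norm_val_omega_lang pad_omega_language[OF assms])
qed

lemma van_der_corput_defined_lang: "van_der_corput_defined lang"
  unfolding van_der_corput_defined_def exponential_growth_def
  using has_growth_base_\<beta> has_val_omega_lang pad_omega_language omega_prefix_pad by blast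

subsection \<open>The reduced language\<close>

lemma lang_strip_a0:
  "w \<in> lang \<Longrightarrow> \<exists>v n. w = v @ replicate n a0 \<and> v \<in> lang \<and> (v = [] \<or> last v \<noteq> a0)"
proof (induction w rule: rev_induct)
  case Nil
  show ?case by (rule exI[of _ "[]"]) simp
next
  case (snoc a w)
  show ?case
  proof (cases "a = a0")
    case True
    from snoc lang_appendD obtain v n where "w = v @ replicate n a0" "v \<in> lang" "v = [] \<or> last v \<noteq> a0"
      by blast
    then show ?thesis using True by (intro exI[of _ v] exI[of _ "Suc n"]) (simp add: replicate_append_same)
  next
    case False
    then show ?thesis using snoc.prems by (intro exI[of _ "w @ [a]"] exI[of _ 0]) simp
  qed
qed

text \<open>Dropping a final \<open>a0\<close> gives a smaller word with the same value. Conversely,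
  a smaller word with the value of \<open>w\<close>, padded to the length of \<open>w\<close>,
  equals \<open>w\<close> by \<open>V_inj\<close>, so \<open>w\<close> ends in \<open>a0\<close>
  unless no padding took place.\<close>

lemma reduced_lang: "reduced_language lang = {w \<in> lang. w = [] \<or> last w \<noteq> a0}"
proof (intro Set.equalityI subsetI)
  fix w assume w: "w \<in> reduced_language lang"
  then have wl: "w \<in> lang" by (simp add: reduced_language_def)
  moreover have False if "w \<noteq> []" "last w = a0"
  proof -
    have eq: "w = butlast w @ replicate 1 a0" using that by (metis One_nat_def append_butlast_last_id replicate_0 replicate_Suc)
    then have b: "butlast w \<in> lang" using wl lang_appendD by metis
    have "V d w = V d (butlast w)" using V_append_a0 eq by metis
    moreover have "(butlast w, w) \<in> shortlex" using that by (simp add: lenlex_conv)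
    ultimately show False using w b wl by (auto simp: reduced_language_def norm_val_lang)
  qed
  ultimately show "w \<in> {w \<in> lang. w = [] \<or> last w \<noteq> a0}" by blast
next
  fix w assume w: "w \<in> {w \<in> lang. w = [] \<or> last w \<noteq> a0}"
  have "V d w \<noteq> V d v" if v: "v \<in> lang" "(v, w) \<in> shortlex" for v
  proof
    assume eq: "V d w = V d v"
    define v' where "v' = v @ replicate (length w - length v) a0"
    have "length v \<le> length w" using v(2) by (rule lenlex_length)
    then have "v' = w" using eq v w
      by (intro V_inj) (auto simp: v'_def lang_append_a0)
    then show False
    proof (cases "length v < length w")
      case True
      then have "last v' = a0" "v' \<noteq> []" by (auto simp: v'_def)
      then show False using \<open>v' = w\<close> w by simp
    next
      case False
      then show False using v(2) \<open>v' = w\<close> shortlex_irrefl by (auto simp: v'_def)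
    qed
  qed
  then show "w \<in> reduced_language lang" using w by (auto simp: reduced_language_def norm_val_lang)
qed

lemma num_ge: "real (num d Q m) \<ge> \<kappa> Q * \<beta> ^ m - count_error"
  using num_err[of d Q m] err_le_count_error[of m] d_Q by (simp add: \<eta>_d abs_le_iff)

text \<open>Stripping final letters \<open>a0\<close> preserves \<open>V\<close>, and
  \<open>V\<close> is injective on words of one length. Finitely many reduced words would therefore
  bound the exponentially growing \<open>num d Q m\<close>.\<close>

lemma infinite_reduced_lang: "infinite (reduced_language lang)"
proof
  assume fin: "finite (reduced_language lang)"
  have bound: "num d Q m \<le> card (reduced_language lang)" for m
  proof -
    let ?A = "{u. length u = m \<and> foldl \<tau> d u \<in> Q}"
    have "inj_on (V d) ?A" by (rule inj_onI) (auto intro!: V_inj simp: mem_lang_iff)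
    then have "num d Q m = card (V d ` ?A)" by (simp add: path_count_def card_image)
    also have "\<dots> \<le> card (V d ` reduced_language lang)"
    proof (rule card_mono)
      show "V d ` ?A \<subseteq> V d ` reduced_language lang"
      proof (rule image_subsetI)
        fix u assume "u \<in> ?A"
        then obtain v n where "u = v @ replicate n a0" "v \<in> lang" "v = [] \<or> last v \<noteq> a0"
          using lang_strip_a0 mem_lang_iff by blast
        then show "V d u \<in> V d ` reduced_language lang" by (auto simp: reduced_lang)
      qed
    qed (use fin in simp)
    also have "\<dots> \<le> card (reduced_language lang)" by (rule card_image_le[OF fin])
    finally show ?thesis .
  qed
  obtain m where "(real (card (reduced_language lang)) + count_error) / \<kappa> Q < \<beta> ^ m"
    using real_arch_pow[OF \<beta>_gt_1] by blast
  then have "real (card (reduced_language lang)) < \<kappa> Q * \<beta> ^ m - count_error"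
    using \<kappa>_pos by (simp add: field_simps)
  with num_ge[of m] bound[of m] show False by linarith
qed

subsection \<open>Discrepancy\<close>

definition block :: "nat \<Rightarrow> 'a list \<Rightarrow> real set \<Rightarrow> 'a list set" where
  "block k s I = {u. length u = k \<and> u @ s \<in> lang \<and> V d (u @ s) \<in> I}"

text \<open>\<open>v\<close> and \<open>z\<close> are mirrored, so a prefix they share becomes a
  suffix of the word; \<open>s\<close> collects this suffix while letters of \<open>z\<close> are
  consumed.\<close>

definition segment :: "'a list \<Rightarrow> 'a list \<Rightarrow> real set \<Rightarrow> 'a list set" where
  "segment z s I = {v. (v, z) \<in> lex letter_order \<and> rev v @ s \<in> lang \<and> V d (rev v @ s) \<in> I}"

lemma finite_block [simp]: "finite (block k s I)"
  unfolding block_def by (rule finite_subset[OF _ finite_words_length[of k]]) auto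

lemma finite_segment [simp]: "finite (segment z s I)"
  unfolding segment_def by (rule finite_subset[OF _ finite_words_lex[of z letter_order]]) auto

section \<open>Discrepancy of a single block\<close>

definition \<kappa>_bound :: real where "\<kappa>_bound = (\<Sum>T\<in>Pow Q. \<bar>\<kappa> T\<bar>)"

lemma \<kappa>_le_bound: "T \<subseteq> Q \<Longrightarrow> \<kappa> T \<le> \<kappa>_bound"
proof -
  assume "T \<subseteq> Q"
  then have "\<bar>\<kappa> T\<bar> \<le> \<kappa>_bound" unfolding \<kappa>_bound_def
    by (intro member_le_sum) (use finite_Q in auto)
  then show ?thesis by simp
qed

text \<open>The first summand accounts for the shift of values caused by the suffix, two of the
  \<open>count_error\<close> for the ranks of the extreme words, the third for the size of the
  block, and 1 for the largest word itself.\<close>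

definition block_error :: real where "block_error = \<kappa>_bound * \<eta>_bound + 3 * count_error + 1"

lemma \<eta>_bound_nonneg: "\<eta>_bound \<ge> 0" unfolding \<eta>_bound_def by (intro sum_nonneg \<eta>_nonneg) auto

lemma \<kappa>_bound_nonneg: "\<kappa>_bound \<ge> 0" unfolding \<kappa>_bound_def by (intro sum_nonneg) auto

lemma block_error_ge_1: "block_error \<ge> 1"
  unfolding block_error_def using \<eta>_bound_nonneg \<kappa>_bound_nonneg count_error_nonneg by simp

text \<open>The words counted lie between two extreme ones, so their number is at most 1 plus a
  difference of two ranks, about \<open>\<kappa> T * \<beta> ^ k\<close> times a difference of
  values. The latter is nearly bounded by the length of \<open>I\<close>, and
  \<open>\<kappa> T * \<beta> ^ k\<close> is nearly the size of the block. An upper bound suffices,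
  since the supremum is taken of signed discrepancies.\<close>

lemma block_discrepancy:
  assumes I: "is_interval I" "I \<subseteq> {0..<1}"
  shows "real (card (block k s I)) \<le> measure lborel I * real (card (block k s UNIV)) + block_error"
proof (cases "block k s I = {}")
  case True
  then show ?thesis using block_error_ge_1 by simp
next
  case False
  \<comment> \<open>With this \<open>T\<close>, membership of \<open>u @ s\<close> in the language
    depends only on the state reached by \<open>u\<close>.\<close>
  define T where "T = {q \<in> Q. foldl \<tau> q s \<in> Q}"
  have T: "T \<subseteq> Q" by (auto simp: T_def)
  have in_T: "u @ s \<in> lang \<longleftrightarrow> foldl \<tau> d u \<in> T" for u
    using lang_appendD[of u s] by (auto simp: mem_lang_iff T_def)
  let ?F = "block k s I"
  have fin: "finite (V d ` ?F)" and ne: "V d ` ?F \<noteq> {}" using False by auto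
  obtain u0 where u0: "u0 \<in> ?F" "\<And>u. u \<in> ?F \<Longrightarrow> V d u0 \<le> V d u"
    using Min_in[OF fin ne] Min_le[OF fin] by force
  obtain u1 where u1: "u1 \<in> ?F" "\<And>u. u \<in> ?F \<Longrightarrow> V d u \<le> V d u1"
    using Max_in[OF fin ne] Max_ge[OF fin] by force
  have lang: "u \<in> lang" "length u = k" if "u \<in> ?F" for u
    using that lang_appendD by (auto simp: block_def)
  let ?B = "\<lambda>w. {u. (u, w) \<in> lex letter_order \<and> foldl \<tau> d u \<in> T}"
  have B_iff: "u \<in> ?B w \<longleftrightarrow> length u = length w \<and> foldl \<tau> d u \<in> T \<and> V d u < V d w" if "w \<in> lang" for u w
    using V_less_iff_lex[of u w] that T by (auto simp: mem_lang_iff lex_length_eq)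
  have sub: "?B u0 \<subseteq> ?B u1"
  proof
    fix u assume "u \<in> ?B u0"
    then have "length u = length u0 \<and> foldl \<tau> d u \<in> T \<and> V d u < V d u0"
      by (rule iffD1[OF B_iff[OF lang(1)[OF u0(1)]]])
    then have "length u = length u1 \<and> foldl \<tau> d u \<in> T \<and> V d u < V d u1"
      using lang(2)[OF u0(1)] lang(2)[OF u1(1)] u0(2)[OF u1(1)] by simp
    then show "u \<in> ?B u1" by (rule iffD2[OF B_iff[OF lang(1)[OF u1(1)]]])
  qed
  \<comment> \<open>Except for \<open>u1\<close> itself, each word counted is below
    \<open>u1\<close> and none is below \<open>u0\<close>.\<close>
  have "?F \<subseteq> insert u1 (?B u1 - ?B u0)"
  proof
    fix u assume u: "u \<in> ?F"
    then have "foldl \<tau> d u \<in> T" using in_T by (auto simp: block_def)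
    moreover have "u \<notin> ?B u0"
      using iffD1[OF B_iff[OF lang(1)[OF u0(1)]], of u] u0(2)[OF u] by linarith
    moreover have "u \<in> ?B u1" if "u \<noteq> u1"
    proof (rule iffD2[OF B_iff[OF lang(1)[OF u1(1)]]])
      have "V d u \<noteq> V d u1" using V_inj[of u u1] lang[OF u] lang[OF u1(1)] that by auto
      then show "length u = length u1 \<and> foldl \<tau> d u \<in> T \<and> V d u < V d u1"
        using \<open>foldl \<tau> d u \<in> T\<close> lang(2)[OF u] lang(2)[OF u1(1)] u1(2)[OF u] by simp
    qed
    ultimately show "u \<in> insert u1 (?B u1 - ?B u0)" by blast
  qed
  moreover have finB: "finite (?B w)" for w by (rule finite_subset[OF _ finite_words_lex[of w letter_order]]) auto
  ultimately have "card ?F \<le> card (insert u1 (?B u1 - ?B u0))" by (intro card_mono) auto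
  also have "\<dots> \<le> Suc (card (?B u1 - ?B u0))" by (rule card_insert_le_m1) auto
  also have "card (?B u1 - ?B u0) = card (?B u1) - card (?B u0)" by (rule card_Diff_subset[OF finB sub])
  finally have "card ?F \<le> Suc (card (?B u1) - card (?B u0))" .
  moreover have "card (?B u0) \<le> card (?B u1)" by (rule card_mono[OF finB sub])
  ultimately have F1: "real (card ?F) \<le> 1 + real (below d T u1) - real (below d T u0)"
    unfolding below_def by linarith
  have \<kappa>: "0 \<le> \<kappa> T" "\<kappa> T \<le> \<kappa>_bound" using \<kappa>_nonneg[OF T] \<kappa>_le_bound[OF T] by auto
  have b: "real (below d T u1) \<le> \<kappa> T * \<beta> ^ k * V d u1 + count_error" "real (below d T u0) \<ge> \<kappa> T * \<beta> ^ k * V d u0 - count_error"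
    using below_err[of d T u1] below_err[of d T u0] T d_Q lang[OF u0(1)] lang[OF u1(1)] by (auto simp: abs_le_iff)
  have "V d (u1 @ s) - V d (u0 @ s) \<le> measure lborel I"
    using u0(1) u1(1) by (intro interval_length_le_measure[OF I]) (auto simp: block_def)
  \<comment> \<open>Only the points with suffix \<open>s\<close> lie in \<open>I\<close>. Removing
    the suffix changes a value by at most \<open>\<eta>_bound / \<beta> ^ k\<close>, which stays
    bounded after multiplication by \<open>\<kappa> T * \<beta> ^ k\<close>.\<close>
  moreover have "V d u1 \<le> V d (u1 @ s)" "V d (u0 @ s) \<le> V d u0 + \<eta>_bound / \<beta> ^ k"
    using V_append_bounds(1)[of u1 s] V_append_bounds(2)[of u0 s] lang[OF u0(1)] by auto
  ultimately have "V d u1 - V d u0 \<le> measure lborel I + \<eta>_bound / \<beta> ^ k" by linarith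
  then have "\<kappa> T * \<beta> ^ k * (V d u1 - V d u0) \<le> \<kappa> T * \<beta> ^ k * (measure lborel I + \<eta>_bound / \<beta> ^ k)"
    using \<kappa> \<beta>_gt_1 by (intro mult_left_mono) auto
  also have "\<dots> = measure lborel I * (\<kappa> T * \<beta> ^ k) + \<kappa> T * \<eta>_bound"
    using \<beta>_gt_1 by (simp add: field_simps)
  also have "\<kappa> T * \<eta>_bound \<le> \<kappa>_bound * \<eta>_bound"
    using \<kappa> \<eta>_bound_nonneg by (intro mult_right_mono)
  also have "\<kappa> T * \<beta> ^ k \<le> real (card (block k s UNIV)) + count_error"
  proof -
    have "block k s UNIV = {u. length u = k \<and> foldl \<tau> d u \<in> T}" by (auto simp: block_def in_T)
    then show ?thesis using num_err[of d T k] err_le_count_error[of k] T d_Q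
      by (simp add: \<eta>_d abs_le_iff path_count_def)
  qed
  also have "measure lborel I * (real (card (block k s UNIV)) + count_error) \<le> measure lborel I * real (card (block k s UNIV)) + count_error"
    using measure_le_1[OF I(2)] count_error_nonneg by (simp add: distrib_left mult_left_le_one_le)
  finally have "\<kappa> T * \<beta> ^ k * (V d u1 - V d u0) \<le> measure lborel I * real (card (block k s UNIV)) + count_error + \<kappa>_bound * \<eta>_bound"
    by (simp add: mult_left_mono)
  then show ?thesis using F1 b by (simp add: block_error_def algebra_simps)
qed

section \<open>Decomposition of a segment into blocks\<close>

lemma segment_Nil [simp]: "segment [] s I = {}" by (auto simp: segment_def)

text \<open>A first letter \<open>b < a\<close> leaves the remaining letters free, which gives a
  block with suffix \<open>b # s\<close>; the letter \<open>a\<close> itself leads on along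
  \<open>z\<close>.\<close>

lemma segment_Cons:
  "segment (a # z) s I = (\<Union>b\<in>{..<a}. (\<lambda>u. b # rev u) ` block (length z) (b # s) I) \<union> (#) a ` segment z (a # s) I"
proof (rule Set.set_eqI)
  fix v
  show "v \<in> segment (a # z) s I \<longleftrightarrow> v \<in> (\<Union>b\<in>{..<a}. (\<lambda>u. b # rev u) ` block (length z) (b # s) I) \<union> (#) a ` segment z (a # s) I"
  proof (cases v)
    case (Cons c v')
    have "v \<in> (\<Union>b\<in>{..<a}. (\<lambda>u. b # rev u) ` block (length z) (b # s) I) \<longleftrightarrow>
        c < a \<and> rev v' \<in> block (length z) (c # s) I"
      by (auto simp: Cons image_iff) (metis rev_rev_ident)
    then show ?thesis by (auto simp: Cons segment_def block_def)
  qed (auto simp: segment_def)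
qed

lemma card_segment_Cons:
  "card (segment (a # z) s I) = (\<Sum>b<a. card (block (length z) (b # s) I)) + card (segment z (a # s) I)"
proof -
  have "card (segment (a # z) s I) =
     card (\<Union>b\<in>{..<a}. (\<lambda>u. b # rev u) ` block (length z) (b # s) I) + card ((#) a ` segment z (a # s) I)"
    unfolding segment_Cons by (rule card_Un_disjoint) auto
  also have "card (\<Union>b\<in>{..<a}. (\<lambda>u. b # rev u) ` block (length z) (b # s) I) =
      (\<Sum>b<a. card ((\<lambda>u. b # rev u) ` block (length z) (b # s) I))"
    by (rule card_UN_disjoint) auto
  also have "\<dots> = (\<Sum>b<a. card (block (length z) (b # s) I))"
    by (intro sum.cong refl card_image) (auto simp: inj_on_def)
  also have "card ((#) a ` segment z (a # s) I) = card (segment z (a # s) I)"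
    by (intro card_image) auto
  finally show ?thesis .
qed

text \<open>Each letter of \<open>z\<close> splits off at most \<open>CARD('a)\<close> blocks, each
  with bounded error.\<close>

lemma segment_discrepancy:
  assumes I: "is_interval I" "I \<subseteq> {0..<1}"
  shows "real (card (segment z s I)) \<le>
     measure lborel I * real (card (segment z s UNIV)) + real (length z) * (real CARD('a) * block_error)"
proof (induction z arbitrary: s)
  case (Cons a z)
  have "real (card (segment (a # z) s I)) =
      (\<Sum>b<a. real (card (block (length z) (b # s) I))) + real (card (segment z (a # s) I))"
    by (simp add: card_segment_Cons)
  also have "\<dots> \<le> (\<Sum>b<a. measure lborel I * real (card (block (length z) (b # s) UNIV)) + block_error) +
      (measure lborel I * real (card (segment z (a # s) UNIV)) + real (length z) * (real CARD('a) * block_error))"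
    by (intro add_mono sum_mono block_discrepancy I Cons.IH)
  also have "\<dots> = measure lborel I * real (card (segment (a # z) s UNIV)) +
      real (card {..<a}) * block_error + real (length z) * (real CARD('a) * block_error)"
    by (simp add: card_segment_Cons sum.distrib sum_distrib_left algebra_simps)
  also have "real (card {..<a}) * block_error \<le> real CARD('a) * block_error"
    using block_error_ge_1 by (intro mult_right_mono) (auto intro: card_mono)
  finally show ?case by (simp add: algebra_simps)
qed simp

section \<open>From the sequence to segments\<close>

abbreviation R :: "'a list set" where "R \<equiv> rev ` reduced_language lang"

lemma infinite_R: "infinite R"
  using infinite_reduced_lang by (simp add: finite_image_iff)

lemma mem_R_iff: "v \<in> R \<longleftrightarrow> rev v \<in> lang \<and> (v = [] \<or> hd v \<noteq> a0)"
proof -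
  have "v \<in> R \<longleftrightarrow> rev v \<in> reduced_language lang" by (metis image_iff rev_rev_ident)
  then show ?thesis by (auto simp: reduced_lang last_rev)
qed

lemma inj_V_R: "inj_on (\<lambda>v. V d (rev v)) R"
proof (rule inj_onI)
  fix u v assume uv: "u \<in> R" "v \<in> R" and eq: "V d (rev u) = V d (rev v)"
  from uv have "rev u \<in> reduced_language lang" "rev v \<in> reduced_language lang"
    by (metis image_iff rev_rev_ident)+
  then have "rev u = rev v"
    using eq shortlex_total[of "rev u" "rev v"] by (auto simp: reduced_language_def norm_val_lang)
  then show "u = v" by simp
qed

lemma van_der_corput_lang: "van_der_corput lang n = V d (rev (rep R n))"
  using rep_mem(1)[OF infinite_R, of n] by (simp add: van_der_corput_def mem_R_iff norm_val_lang)

text \<open>Padding a mirrored reduced word in front with \<open>a0\<close> brings it to the length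
  of \<open>z\<close> without changing its value. A word that was shorter then starts with
  \<open>a0\<close>, which is below the first letter of \<open>z\<close> by assumption. Stripping
  the leading \<open>a0\<close> goes back.\<close>

lemma image_V_R:
  assumes z: "z = [] \<or> hd z \<noteq> a0"
  shows "(\<lambda>v. V d (rev v)) ` {v \<in> R. (v, z) \<in> shortlex} = (\<lambda>v. V d (rev v)) ` segment z [] UNIV"
proof (intro Set.equalityI image_subsetI)
  fix v assume v: "v \<in> {v \<in> R. (v, z) \<in> shortlex}"
  define n where "n = length z - length v"
  define v' where "v' = replicate n a0 @ v"
  have len: "length v \<le> length z" using v by (auto dest: lenlex_length)
  have "(v', z) \<in> lex letter_order"
  proof (cases "n = 0")
    case True
    then show ?thesis using v len by (auto simp: v'_def n_def lenlex_conv)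
  next
    case False
    then obtain c z' where zc: "z = c # z'" by (cases z) (auto simp: n_def)
    then have "a0 < c" using z a0_le[of c] by (simp add: order_less_le)
    moreover have "v' = a0 # replicate (n - 1) a0 @ v" using False by (cases n) (auto simp: v'_def)
    ultimately show ?thesis using zc len False by (auto simp: n_def)
  qed
  then have "v' \<in> segment z [] UNIV"
    using v by (auto simp: segment_def v'_def lang_append_a0 mem_R_iff)
  moreover have "V d (rev v') = V d (rev v)" by (simp add: v'_def)
  ultimately show "V d (rev v) \<in> (\<lambda>v. V d (rev v)) ` segment z [] UNIV" by (metis image_eqI)
next
  fix v assume "v \<in> segment z [] UNIV"
  then have v: "(v, z) \<in> lex letter_order" "rev v \<in> lang" by (auto simp: segment_def)
  then obtain w n where w: "rev v = w @ replicate n a0" "w \<in> lang" "w = [] \<or> last w \<noteq> a0"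
    using lang_strip_a0 by blast
  have veq: "v = replicate n a0 @ rev w" using w(1) by (metis rev_append rev_replicate rev_rev_ident)
  have "(rev w, z) \<in> shortlex"
    using v(1) veq lex_length_eq[OF v(1)] by (cases "n = 0") (auto simp: lenlex_conv)
  moreover have "rev w \<in> R" using w by (auto simp: mem_R_iff hd_rev)
  moreover have "V d (rev v) = V d (rev (rev w))" by (simp add: w(1))
  ultimately show "V d (rev v) \<in> (\<lambda>v. V d (rev v)) ` {v \<in> R. (v, z) \<in> shortlex}" by blast
qed

text \<open>Both sides count points: the terms of the sequence are distinct, and so are the values
  on a segment, whose words have equal length. For \<open>I = UNIV\<close> the segment has
  \<open>N\<close> elements.\<close>

lemma card_van_der_corput:
  "card {n. n < N \<and> van_der_corput lang n \<in> I} = card (segment (rep R N) [] I)"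
proof -
  let ?z = "rep R N" and ?g = "\<lambda>v. V d (rev v)"
  have z: "?z = [] \<or> hd ?z \<noteq> a0" using rep_mem(1)[OF infinite_R, of N] by (simp add: mem_R_iff)
  have inj: "inj_on (\<lambda>n. ?g (rep R n)) UNIV"
    using comp_inj_on[of "rep R" UNIV ?g] inj_rep[OF infinite_R] inj_on_subset[OF inj_V_R, of "range (rep R)"]
      rep_mem(1)[OF infinite_R] by (auto simp: comp_def)
  have "card {n. n < N \<and> van_der_corput lang n \<in> I} = card ((\<lambda>n. ?g (rep R n)) ` {n. n < N \<and> ?g (rep R n) \<in> I})"
    unfolding van_der_corput_lang by (rule card_image[symmetric]) (rule inj_on_subset[OF inj], simp)
  also have "(\<lambda>n. ?g (rep R n)) ` {n. n < N \<and> ?g (rep R n) \<in> I} = ?g ` (rep R ` {..<N}) \<inter> I" by auto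
  also have "\<dots> = ?g ` segment ?z [] UNIV \<inter> I"
    by (simp only: rep_image_lessThan[OF infinite_R] image_V_R[OF z])
  also have "\<dots> = ?g ` segment ?z [] I" by (auto simp: segment_def)
  also have "card \<dots> = card (segment ?z [] I)"
  proof (rule card_image, rule inj_onI)
    fix u v assume uv: "u \<in> segment ?z [] I" "v \<in> segment ?z [] I" and "?g u = ?g v"
    then have "rev u = rev v"
      by (intro V_inj) (auto simp: segment_def dest!: lex_length_eq)
    then show "u = v" by simp
  qed
  finally show ?thesis .
qed

text \<open>The representation starts with a letter above \<open>a0\<close>, so the branch
  \<open>a0\<close> at its first position is a full block. It contains all accepted words of length
  one less, which explains the exponent.\<close>

lemma rep_length_bound:
  assumes "N \<ge> 1"
  shows "\<kappa> Q * \<beta> ^ (length (rep R N) - 1) \<le> real N + count_error"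
proof -
  let ?z = "rep R N"
  have "?z \<noteq> []"
  proof
    assume "?z = []"
    then have "val R ?z = 0" by (simp add: val_def)
    then show False using rep_mem(2)[OF infinite_R, of N] assms by simp
  qed
  then obtain c z where z: "?z = c # z" by (cases ?z) auto
  then have "a0 < c" using rep_mem(1)[OF infinite_R, of N] a0_le[of c] by (auto simp: mem_R_iff order_less_le)
  have "real N = real (card (segment ?z [] UNIV))" using card_van_der_corput[of N UNIV] by simp
  also have "\<dots> \<ge> real (card (block (length z) [a0] UNIV))"
  proof -
    have "card (block (length z) [a0] UNIV) \<le> (\<Sum>b<c. card (block (length z) [b] UNIV))"
      by (rule member_le_sum[of a0]) (use \<open>a0 < c\<close> in auto)
    also have "\<dots> \<le> card (segment ?z [] UNIV)" by (simp add: z card_segment_Cons)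
    finally show ?thesis by simp
  qed
  also have "block (length z) [a0] UNIV = {u. length u = length z \<and> foldl \<tau> d u \<in> Q}"
    using lang_append_a0[of _ 1] by (auto simp: block_def mem_lang_iff)
  finally have "real N \<ge> real (num d Q (length z))" by (simp add: path_count_def)
  then show ?thesis using num_ge[of "length z"] z by simp
qed

lemma low_discrepancy_lang: "low_discrepancy (van_der_corput lang)"
proof -
  let ?S = "\<lambda>N. SUP I\<in>{I. is_interval I \<and> I \<subseteq> {0..<1}}. discrepancy (van_der_corput lang) N I"
  define C where "C = real CARD('a) * block_error"
  have "C > 0" using block_error_ge_1 by (simp add: C_def)
  then have C: "C \<ge> 0" by simp
  \<comment> \<open>Adding 1 to \<open>count_error\<close> makes the offset inside the logarithm
    positive, as the asymptotic estimate of \<open>B\<close> requires.\<close>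
  define B where "B N = C * (1 + ln ((real N + (count_error + 1)) / \<kappa> Q) / ln \<beta>)" for N
  have disc: "discrepancy (van_der_corput lang) N I \<le> B N"
    if "N \<ge> 1" "is_interval I" "I \<subseteq> {0..<1}" for N I
  proof -
    let ?z = "rep R N"
    have "card (segment ?z [] UNIV) = N" using card_van_der_corput[of N UNIV] by simp
    then have 1: "discrepancy (van_der_corput lang) N I \<le> real (length ?z) * C"
      using segment_discrepancy[OF that(2,3), of ?z "[]"] card_van_der_corput[of N I]
      by (simp add: discrepancy_def C_def mult.commute)
    have "real (length ?z) \<le> 1 + ln ((real N + (count_error + 1)) / \<kappa> Q) / ln \<beta>"
    proof -
      have "\<beta> ^ (length ?z - 1) \<le> (real N + (count_error + 1)) / \<kappa> Q"
        using rep_length_bound[OF that(1)] \<kappa>_pos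
        by (simp add: pos_le_divide_eq mult.commute)
      then have "ln (\<beta> ^ (length ?z - 1)) \<le> ln ((real N + (count_error + 1)) / \<kappa> Q)"
        using \<beta>_gt_1 by (subst ln_le_cancel_iff) (auto intro: less_le_trans[of 0 "\<beta> ^ (length ?z - 1)"])
      then have "real (length ?z - 1) * ln \<beta> \<le> ln ((real N + (count_error + 1)) / \<kappa> Q)"
        using \<beta>_gt_1 by (simp add: ln_realpow)
      then have "real (length ?z - 1) \<le> ln ((real N + (count_error + 1)) / \<kappa> Q) / ln \<beta>"
        using \<beta>_gt_1 by (simp add: pos_le_divide_eq)
      then show ?thesis by linarith
    qed
    from mult_right_mono[OF this C] have "real (length ?z) * C \<le> B N"
      by (simp add: B_def mult.commute[of C])
    with 1 show ?thesis by linarith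
  qed
  have "norm (?S N) \<le> norm (B N)" if "N \<ge> 1" for N
  proof -
    have "?S N \<le> B N"
      by (rule cSUP_least) (use disc[OF that] in auto)
    \<comment> \<open>The empty interval has discrepancy 0, so the one-sided bound also bounds the
      norm.\<close>
    moreover have "0 \<le> ?S N"
    proof (rule cSUP_upper2[where x = "{}"])
      show "bdd_above (discrepancy (van_der_corput lang) N ` {I. is_interval I \<and> I \<subseteq> {0..<1}})"
        using disc[OF that] by (auto intro!: bdd_aboveI2[where M = "B N"])
    qed (auto simp: discrepancy_def)
    ultimately show ?thesis by simp
  qed
  then have "?S \<in> O(B)"
    by (intro bigoI[of _ 1]) (auto intro!: eventually_sequentiallyI[of 1])
  also have "B \<in> O(\<lambda>N. ln (real N))"
  proof -
    have "(\<lambda>N. C * (1 + ln ((real N + K') / k) / l)) \<in> O(\<lambda>N. ln (real N))"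
      if "k > 0" "l > 0" "K' > 0" for k l K' :: real
      using that \<open>C > 0\<close> by real_asymp
    then show ?thesis unfolding B_def using \<kappa>_pos \<beta>_gt_1 count_error_nonneg by simp
  qed
  finally show ?thesis unfolding low_discrepancy_def .
qed

end

section \<open>Pisot automata\<close>

text \<open>For each \<open>T\<close> the counts are an orbit of the incidence matrix. The factor
  \<open>P\<close> comes from the eigenvector and so does not depend on \<open>T\<close>; only
  \<open>H\<close> does.\<close>

lemma pisot_automaton_path_count:
  fixes M :: "('q::linorder, 'a::finite) automaton"
  defines "Q \<equiv> {q \<in> states M. accessible M q \<and> coaccessible M q}"
  assumes det: "deterministic_automaton M" and pisot: "pisot_automaton M"
  shows "\<exists>\<beta> :: real. \<exists>(P :: 'q \<Rightarrow> complex) (H :: 'q set \<Rightarrow> complex). \<beta> > 1 \<and> (\<forall>q\<in>Q. \<forall>T\<subseteq>Q.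
    summable (\<lambda>m. cmod (of_nat (path_count (step M) q T m) - P q * H T * of_real \<beta> ^ m)))"
proof -
  have finQ: "finite Q" using det by (simp add: Q_def deterministic_automaton_def)
  define qs where "qs = sorted_list_of_set Q"
  define n where "n = length qs"
  define A where "A = incidence_matrix M"
  have qs: "set qs = Q" "distinct qs" using finQ by (auto simp: qs_def)
  have Aeq: "A = Matrix.mat n n (\<lambda>(i, j). of_nat (card {a. step M (qs ! i) a = qs ! j}))"
    unfolding A_def incidence_matrix_def Let_def n_def qs_def Q_def by simp
  have A: "A \<in> carrier_mat n n" by (simp add: Aeq)
  obtain \<beta> :: real where \<beta>: "\<beta> > 1" "Polynomial.order (complex_of_real \<beta>) (char_poly A) = 1"
      "\<And>\<alpha>. eigenvalue A \<alpha> \<Longrightarrow> \<alpha> \<noteq> complex_of_real \<beta> \<Longrightarrow> cmod \<alpha> < 1"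
    using pisot unfolding pisot_automaton_def A_def by blast
  have norm_\<beta>: "cmod (complex_of_real \<beta>) > 1" using \<beta>(1) by simp
  obtain p :: "nat \<Rightarrow> complex" where p: "\<forall>v :: nat \<Rightarrow> nat \<Rightarrow> complex.
       (\<forall>m. \<forall>i<n. v (Suc m) i = (\<Sum>j<n. A $$ (i, j) * v m j)) \<longrightarrow>
       (\<exists>H. \<forall>i<n. summable (\<lambda>m. cmod (v m i - p i * H * complex_of_real \<beta> ^ m)))"
    by (rule exE[OF dominant_eigenvalue_asymptotics[OF A \<beta>(2) norm_\<beta> \<beta>(3)]])
      (assumption, assumption, rule that)
  have "\<exists>H. \<forall>i<n. summable (\<lambda>m. cmod (of_nat (path_count (step M) (qs ! i) T m) - p i * H * complex_of_real \<beta> ^ m))"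
    if T: "T \<subseteq> Q" for T
  proof (rule p[rule_format])
    fix m i assume i: "i < n"
    define q where "q = qs ! i"
    have q: "q \<in> Q" using i qs(1) by (auto simp: q_def n_def)
    let ?f = "\<lambda>r. complex_of_nat (path_count (step M) r T m)"
    \<comment> \<open>A successor outside \<open>Q\<close> is accessible, hence not co-accessible,
      and cannot reach \<open>T\<close>; restricting the matrix to \<open>Q\<close> loses no
      words.\<close>
    have outside: "path_count (step M) (step M q a) T m = 0" if "step M q a \<notin> Q" for a
    proof -
      have "step M q a \<in> states M" using q det by (auto simp: Q_def deterministic_automaton_def)
      moreover have "accessible M (step M q a)"
      proof -
        obtain w where "q = run M (start M) w" using q by (auto simp: Q_def accessible_def)
        then have "step M q a = run M (start M) (w @ [a])" by (simp add: run_def)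
        then show ?thesis unfolding accessible_def by blast
      qed
      ultimately have nco: "\<not> coaccessible M (step M q a)" using that by (simp add: Q_def)
      have "foldl (step M) (step M q a) u \<notin> T" for u
      proof
        assume "foldl (step M) (step M q a) u \<in> T"
        then have "coaccessible M (foldl (step M) (step M q a) u)" using T by (auto simp: Q_def)
        then obtain w where "run M (foldl (step M) (step M q a) u) w \<in> finals M" by (auto simp: coaccessible_def)
        then have "run M (step M q a) (u @ w) \<in> finals M" by (simp add: run_def)
        with nco show False unfolding coaccessible_def by blast
      qed
      then show ?thesis by (simp add: path_count_def)
    qed
    have "complex_of_nat (path_count (step M) q T (Suc m)) = (\<Sum>a\<in>UNIV. ?f (step M q a))"
      by (simp add: path_count_Suc)
    also have "\<dots> = (\<Sum>a\<in>{a \<in> UNIV. step M q a \<in> Q}. ?f (step M q a))"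
      by (rule sum.mono_neutral_right) (auto simp: outside)
    \<comment> \<open>Grouping the letters by target state produces the matrix entries.\<close>
    also have "\<dots> = (\<Sum>r\<in>Q. \<Sum>a\<in>{a. a \<in> {a \<in> UNIV. step M q a \<in> Q} \<and> step M q a = r}. ?f (step M q a))"
      by (rule sum.group[symmetric]) (use finQ in auto)
    also have "\<dots> = (\<Sum>r\<in>Q. of_nat (card {a. step M q a = r}) * ?f r)"
    proof (rule sum.cong[OF refl])
      fix r assume r: "r \<in> Q"
      have "(\<Sum>a\<in>{a. a \<in> {a \<in> UNIV. step M q a \<in> Q} \<and> step M q a = r}. ?f (step M q a)) =
          (\<Sum>a\<in>{a. step M q a = r}. ?f r)"
        by (rule sum.cong) (use r in auto)
      then show "(\<Sum>a\<in>{a. a \<in> {a \<in> UNIV. step M q a \<in> Q} \<and> step M q a = r}. ?f (step M q a)) =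
          of_nat (card {a. step M q a = r}) * ?f r" by simp
    qed
    also have "\<dots> = (\<Sum>j<n. of_nat (card {a. step M q a = qs ! j}) * ?f (qs ! j))"
      by (rule sum.reindex_bij_betw[symmetric, OF bij_betw_nth]) (use qs in \<open>auto simp: n_def\<close>)
    also have "\<dots> = (\<Sum>j<n. A $$ (i, j) * ?f (qs ! j))"
      using i by (simp add: Aeq q_def)
    finally show "of_nat (path_count (step M) (qs ! i) T (Suc m)) = (\<Sum>j<n. A $$ (i, j) * ?f (qs ! j))"
      by (simp add: q_def)
  qed
  then have "\<forall>T\<in>Pow Q. \<exists>H. \<forall>i<n. summable (\<lambda>m. cmod (of_nat (path_count (step M) (qs ! i) T m) - p i * H * complex_of_real \<beta> ^ m))"
    by blast
  then obtain H where H: "\<And>T i. T \<subseteq> Q \<Longrightarrow> i < n \<Longrightarrow>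
      summable (\<lambda>m. cmod (of_nat (path_count (step M) (qs ! i) T m) - p i * H T * complex_of_real \<beta> ^ m))"
    by (meson Pow_iff)
  have "\<forall>q\<in>Q. \<exists>i<n. qs ! i = q" using qs(1) by (auto simp: n_def in_set_conv_nth)
  then obtain idx where idx: "\<And>q. q \<in> Q \<Longrightarrow> idx q < n \<and> qs ! idx q = q" by metis
  show ?thesis
  proof (intro exI[of _ \<beta>] exI[of _ "\<lambda>q. p (idx q)"] exI[of _ H] conjI \<beta>(1) ballI allI impI)
    fix q T assume "q \<in> Q" "T \<subseteq> Q"
    then show "summable (\<lambda>m. cmod (of_nat (path_count (step M) q T m) - p (idx q) * H T * of_real \<beta> ^ m))"
      using H[of T "idx q"] idx[of q] by simp
  qed
qed

text \<open>The counts are real, so the error has imaginary part of modulus at least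
  \<open>\<bar>Im z\<bar>\<close>, whereas it tends to 0.\<close>

lemma power_asymptotics_real_coefficient:
  fixes N :: "nat \<Rightarrow> nat" and z :: complex
  assumes s: "summable (\<lambda>m. cmod (of_nat (N m) - z * of_real \<beta> ^ m))" and \<beta>: "\<beta> > 1"
  shows "z = of_real (Re z)"
proof -
  have "\<bar>Im z\<bar> \<le> cmod (of_nat (N m) - z * of_real \<beta> ^ m)" for m
  proof -
    have "1 * \<bar>Im z\<bar> \<le> \<beta> ^ m * \<bar>Im z\<bar>" using \<beta> by (intro mult_right_mono one_le_power) auto
    also have "\<dots> = \<bar>Im (of_nat (N m) - z * of_real (\<beta> ^ m))\<bar>"
    proof -
      have "Im (of_nat (N m) - z * of_real x) = - (Im z * x)" for x by simp
      then show ?thesis using \<beta> by (simp only: abs_minus_cancel abs_mult) simp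
    qed
    also have "\<dots> \<le> cmod (of_nat (N m) - z * of_real (\<beta> ^ m))" by (rule abs_Im_le_cmod)
    finally show ?thesis by simp
  qed
  then have "\<bar>Im z\<bar> \<le> 0" using LIMSEQ_le_const[OF summable_LIMSEQ_zero[OF s]] by blast
  then show ?thesis by (simp add: complex_eq_iff)
qed

theorem theorem1:
  fixes L :: "'a::{finite,linorder} list set"
    and d :: nat
    and \<tau> :: "nat \<Rightarrow> 'a \<Rightarrow> nat"
    and M :: "(nat, 'a) automaton"
  assumes "numeration_system L"
    and "d \<ge> 1"
    and "M = \<lparr>states = {0..d}, step = \<tau>, start = d, finals = {1..d}\<rparr>"
    and "deterministic_automaton M"
    and "L = language M"
    and "totally_ordered_by M {(q, r). q \<in> states M \<and> r \<in> states M \<and> q \<le> r}"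
    and "pisot_automaton M"
    and "\<And>a. \<tau> 0 a = 0"
    and "\<And>q. q \<in> states M \<Longrightarrow> q > 0 \<Longrightarrow> \<tau> q (Min UNIV) > 0"
  shows "van_der_corput_defined L \<and> low_discrepancy (van_der_corput L)"
proof -
  note M = assms(3)
  define Q where "Q = {q \<in> states M. accessible M q \<and> coaccessible M q}"
  have step_le: "\<tau> q a \<le> d" if "q \<le> d" for q a
    using assms(4) that by (auto simp: M deterministic_automaton_def)
  have run_le: "foldl \<tau> q w \<le> d" if "q \<le> d" for q w
    using that by (induction w arbitrary: q) (auto simp: step_le)
  have run_0: "foldl \<tau> 0 w = 0" for w by (induction w) (auto simp: assms(8))
  \<comment> \<open>The sink never reaches a final state, while every nonzero state is final and
    thus co-accessible by the empty word.\<close>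
  have Q_iff: "q \<in> Q \<longleftrightarrow> 0 < q \<and> (\<exists>w. q = foldl \<tau> d w)" for q
  proof
    assume "q \<in> Q"
    then show "0 < q \<and> (\<exists>w. q = foldl \<tau> d w)"
      using run_0 by (cases "q = 0") (auto simp: Q_def M accessible_def coaccessible_def run_def)
  next
    assume q: "0 < q \<and> (\<exists>w. q = foldl \<tau> d w)"
    then have "q \<le> d" using run_le by auto
    moreover have "coaccessible M q" unfolding coaccessible_def
      by (rule exI[of _ "[]"]) (use q \<open>q \<le> d\<close> in \<open>auto simp: M run_def\<close>)
    ultimately show "q \<in> Q" using q by (auto simp: Q_def M accessible_def run_def)
  qed
  have dQ: "d \<in> Q" unfolding Q_iff using assms(2) by (auto intro: exI[of _ "[]"])
  have Q0: "0 \<notin> Q" by (simp add: Q_iff)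
  have stepQ: "\<tau> q a \<in> insert 0 Q" if q: "q \<in> Q" for q a
  proof -
    obtain w where "q = foldl \<tau> d w" using q by (auto simp: Q_iff)
    then have "\<tau> q a = foldl \<tau> d (w @ [a])" by simp
    then have "\<exists>w. \<tau> q a = foldl \<tau> d w" by blast
    then show ?thesis by (cases "\<tau> q a = 0") (simp_all add: Q_iff)
  qed
  have Min_pos: "\<tau> q (Min UNIV) \<noteq> 0" if "q \<in> Q" for q
    using assms(9)[of q] that Q_iff[of q] by (simp add: Q_def)
  have runQ: "foldl \<tau> q (replicate m (Min UNIV)) \<in> Q" if "q \<in> Q" for q m
    using that
  proof (induction m arbitrary: q)
    case (Suc m)
    then show ?case using stepQ[OF Suc.prems, of "Min UNIV"] Min_pos[OF Suc.prems] by auto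
  qed simp
  have "step M = \<tau>" by (simp add: M)
  with pisot_automaton_path_count[OF assms(4,7), folded Q_def]
  obtain \<beta> P H where \<beta>: "\<beta> > 1" and PH': "\<forall>q\<in>Q. \<forall>T\<subseteq>Q.
       summable (\<lambda>m. cmod (of_nat (path_count \<tau> q T m) - P q * H T * complex_of_real \<beta> ^ m))"
    by (simp only:) (elim exE conjE, rule that)
  have PH: "summable (\<lambda>m. cmod (of_nat (path_count \<tau> q T m) - P q * H T * of_real \<beta> ^ m))"
    if "q \<in> Q" "T \<subseteq> Q" for q T
    using PH' that by blast
  \<comment> \<open>The eigenvector may carry a complex scalar, but the products are real.\<close>
  have real: "P q * H T = of_real (Re (P q * H T))" if "q \<in> Q" "T \<subseteq> Q" for q T
    by (rule power_asymptotics_real_coefficient[OF PH[OF that] \<beta>])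
  have sum: "summable (\<lambda>m. \<bar>real (path_count \<tau> q T m) - Re (P q * H T) * \<beta> ^ m\<bar>)"
    if "q \<in> Q" "T \<subseteq> Q" for q T
  proof -
    have "\<bar>real (path_count \<tau> q T m) - Re (P q * H T) * \<beta> ^ m\<bar> =
        cmod (of_nat (path_count \<tau> q T m) - P q * H T * of_real \<beta> ^ m)" for m
    proof -
      have "of_nat (path_count \<tau> q T m) - P q * H T * of_real \<beta> ^ m =
          complex_of_real (real (path_count \<tau> q T m) - Re (P q * H T) * \<beta> ^ m)"
        by (subst real[OF that]) simp
      then show ?thesis by (metis norm_of_real)
    qed
    then show ?thesis using PH[OF that] by simp
  qed
  define c where "c q = Re (P q * H Q)" for q
  \<comment> \<open>Otherwise the count, at least 1 because of the words over \<open>a0\<close>,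
    could not approach its main term.\<close>
  have cpos: "c q > 0" if q: "q \<in> Q" for q
  proof (rule ccontr)
    assume "\<not> c q > 0"
    have "1 \<le> \<bar>real (path_count \<tau> q Q m) - c q * \<beta> ^ m\<bar>" for m
    proof -
      have "replicate m (Min UNIV) \<in> {u. length u = m \<and> foldl \<tau> q u \<in> Q}" using runQ[OF q] by simp
      then have "{u. length u = m \<and> foldl \<tau> q u \<in> Q} \<noteq> {}" by blast
      moreover have "finite {u. length u = m \<and> foldl \<tau> q u \<in> Q}"
        by (rule finite_subset[OF _ finite_words_length[of m]]) auto
      ultimately have "0 < path_count \<tau> q Q m" by (simp only: path_count_def card_gt_0_iff) simp
      moreover have "c q * \<beta> ^ m \<le> 0" using \<open>\<not> c q > 0\<close> \<beta> by (simp add: mult_nonpos_nonneg)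
      ultimately show ?thesis by linarith
    qed
    moreover have "(\<lambda>m. \<bar>real (path_count \<tau> q Q m) - c q * \<beta> ^ m\<bar>) \<longlonglongrightarrow> 0"
      unfolding c_def by (rule summable_LIMSEQ_zero[OF sum[OF q]]) simp
    ultimately have "(1::real) \<le> 0" by (meson LIMSEQ_le_const)
    then show False by simp
  qed
  \<comment> \<open>Dividing by \<open>c d\<close> cancels the scalar of the eigenvector and
    normalizes \<open>\<eta> d\<close> to 1.\<close>
  define \<eta> where "\<eta> q = (if q = 0 then 0 else c q / c d)" for q
  define \<kappa> where "\<kappa> T = Re (P d * H T)" for T
  \<comment> \<open>The product form of the coefficients is decisive: \<open>H Q\<close> and
    \<open>P d\<close> cancel in \<open>(P d * H T) * (P q * H Q) / (P d * H Q)\<close>.\<close>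
  have prod: "\<kappa> T * \<eta> q = Re (P q * H T)" if "q \<in> Q" "T \<subseteq> Q" for q T
  proof -
    have "P d * H Q \<noteq> 0" using cpos[OF dQ] by (auto simp: c_def)
    have "complex_of_real (\<kappa> T * \<eta> q) = (P d * H T) * (P q * H Q) / (P d * H Q)"
      using that Q0 dQ real[of d T] real[of q Q] real[of d Q] by (auto simp: \<kappa>_def \<eta>_def c_def)
    also have "\<dots> = P q * H T" using \<open>P d * H Q \<noteq> 0\<close> by simp
    also have "\<dots> = of_real (Re (P q * H T))" by (rule real[OF that])
    finally show ?thesis by (simp only: of_real_eq_iff)
  qed
  interpret pisot_tree \<tau> Q d \<beta> \<eta> \<kappa>
  proof
    show "finite Q" by (simp add: Q_def M)
    show "\<eta> d = 1" using cpos[OF dQ] assms(2) by (simp add: \<eta>_def)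
    show "\<eta> q > 0" if "q \<in> Q" for q
      using cpos[OF that] cpos[OF dQ] that Q_iff[of q] by (simp add: \<eta>_def)
    show "summable (\<lambda>m. \<bar>real (path_count \<tau> q T m) - \<kappa> T * \<eta> q * \<beta> ^ m\<bar>)" if "q \<in> Q" "T \<subseteq> Q" for q T
      unfolding prod[OF that] by (rule sum[OF that])
  qed (use dQ Q0 stepQ Min_pos assms(8) \<beta> in \<open>auto simp: \<eta>_def\<close>)
  \<comment> \<open>A run from \<open>d\<close> stays in \<open>{0..d}\<close>, so ending in
    \<open>{1..d}\<close> amounts to avoiding 0.\<close>
  have "L = lang" using run_le[of d] by (auto simp: assms(5) language_def lang_def M run_def Suc_le_eq)
  then show ?thesis using van_der_corput_defined_lang low_discrepancy_lang by simp
qed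

end
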